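(* Consider the setting of the modular convex Nash equilibrium problem (the spaces $\mathcal{H}_i,\mathcal{G}_k,\boldsymbol{\mathcal{H}},\boldsymbol{\mathcal{G}}$, the functions $\varphi_i,\boldsymbol{f}_i,g_k$, and the operators $\boldsymbol{L}_k,\boldsymbol{G}$, with assumptions [a]–[c]) described in the context. Set $$\boldsymbol{C}=\big\{(\boldsymbol{L}_k\boldsymbol{x}-y_k)_{k\in K}\;\big|\;(\forall i\in I)\;x_i\in\operatorname{dom}\varphi_i\ \text{ and }\ (\forall k\in K)\;y_k\in\operatorname{dom}g_k\big\},$$ and let $\boldsymbol{Z}\subset\boldsymbol{\mathcal{H}}\oplus\boldsymbol{\mathcal{G}}$ be the set of all $(\overline{\boldsymbol{x}},\overline{\boldsymbol{v}}^* )\in\boldsymbol{\mathcal{H}}\oplus\boldsymbol{\mathcal{G}}$ such that $$\begin{cases}(\forall i\in I)\;\;-\nabla_i\boldsymbol{f}_i(\overline{\boldsymbol{x}})-\sum_{k\in K}\Pi_i(\boldsymbol{L}_k^*\overline{v}_k^* )\in\partial\varphi_i(\overline{x}_i)\\(\forall k\in K)\;\;\boldsymbol{L}_k\overline{\boldsymbol{x}}\in\partial g_k^*(\overline{v}_k^* ),\end{cases}$$ where, for every $i\in I$, $\Pi_i\colon\boldsymbol{\mathcal{H}}\to\mathcal{H}_i\colon\boldsymbol{x}\mapsto x_i$. Suppose that $\boldsymbol{0}\in\operatorname{sri}\boldsymbol{C}$ and that one of the following is satisfied: (i) For every $i\in I$, one of the following holds: 1/ $\partial\varphi_i$ is surjective.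 2/ $\varphi_i$ is supercoercive. 3/ $\operatorname{dom}\varphi_i$ is bounded. 4/ $\varphi_i$ is uniformly convex. (ii) $\boldsymbol{G}\colon\boldsymbol{\mathcal{H}}\to\boldsymbol{\mathcal{H}}\colon\boldsymbol{x}\mapsto(\nabla_i\boldsymbol{f}_i(\boldsymbol{x}))_{i\in I}$ is $3^*$ monotone and surjective. Then $\boldsymbol{Z}\neq\varnothing$ and the modular convex Nash equilibrium problem has a solution, that is, there exists $\boldsymbol{x}\in\boldsymbol{\mathcal{H}}$ such that $$(\forall i\in I)\quad x_i\in\operatorname{Argmin}\Big(\varphi_i+\boldsymbol{f}_i(\,\cdot\,;\boldsymbol{x}_{\smallsetminus i})+\sum_{k\in K}(g_k\circ\boldsymbol{L}_k)(\,\cdot\,;\boldsymbol{x}_{\smallsetminus i})\Big).$$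
   Context: **Setting (modular convex Nash equilibrium problem).** Let $I=\{1,\ldots,p\}$ and let $K$ be a finite set. Let $(\mathcal{H}_i)_{i\in I}$ and $(\mathcal{G}_k)_{k\in K}$ be finite families of real Hilbert spaces, and let $\boldsymbol{\mathcal{H}}=\bigoplus_{i\in I}\mathcal{H}_i$ and $\boldsymbol{\mathcal{G}}=\bigoplus_{k\in K}\mathcal{G}_k$ be their Hilbert direct sums. Generic elements are written $\boldsymbol{x}=(x_i)_{i\in I}\in\boldsymbol{\mathcal{H}}$ and $\boldsymbol{v}^*=(v_k^* )_{k\in K}\in\boldsymbol{\mathcal{G}}$. For $i\in I$ and $\boldsymbol{x}\in\boldsymbol{\mathcal{H}}$, $\boldsymbol{x}_{\smallsetminus i}=(x_j)_{j\in I\smallsetminus\{i\}}$; for $x_i\in\mathcal{H}_i$ and $\boldsymbol{y}\in\boldsymbol{\mathcal{H}}$, $(x_i;\boldsymbol{y}_{\smallsetminus i})=(y_1,\ldots,y_{i-1},x_i,y_{i+1},\ldots,y_p)$. For a function $\boldsymbol{h}$ on $\boldsymbol{\mathcal{H}}$, $\boldsymbol{h}(\,\cdot\,;\boldsymbol{x}_{\smallsetminus i})$ is the function $x_i'\mapsto\boldsymbol{h}(x_i';\boldsymbol{x}_{\smallsetminus i})$ on $\mathcal{H}_i$. $\Gamma_0(\mathcal{H})$ denotes the class of lower semicontinuous convex functions $\varphi\colon\mathcal{H}\to\,]-\infty,+\infty]$ on a real Hilbert space $\mathcal{H}$ which are proper, i.e., $\operatorname{dom}\varphi=\{x\in\mathcal{H}\mid\varphi(x)<+\infty\}\neq\varnothing$.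 The following are assumed: - [a] For every $i\in I$, $\varphi_i\in\Gamma_0(\mathcal{H}_i)$. - [b] For every $i\in I$, $\boldsymbol{f}_i\colon\boldsymbol{\mathcal{H}}\to\mathbb{R}$ is such that, for every $\boldsymbol{x}\in\boldsymbol{\mathcal{H}}$, $\boldsymbol{f}_i(\,\cdot\,;\boldsymbol{x}_{\smallsetminus i})\colon\mathcal{H}_i\to\mathbb{R}$ is convex and differentiable, and its gradient at $x_i$ is denoted by $\nabla_i\boldsymbol{f}_i(\boldsymbol{x})$. Further, the operator $\boldsymbol{G}\colon\boldsymbol{\mathcal{H}}\to\boldsymbol{\mathcal{H}}\colon\boldsymbol{x}\mapsto(\nabla_i\boldsymbol{f}_i(\boldsymbol{x}))_{i\in I}$ is monotone and Lipschitzian. - [c] For every $k\in K$, $g_k\in\Gamma_0(\mathcal{G}_k)$ and $\boldsymbol{L}_k\colon\boldsymbol{\mathcal{H}}\to\mathcal{G}_k$ is linear and bounded. The problem is to find $\boldsymbol{x}\in\boldsymbol{\mathcal{H}}$ such that, for every $i\in I$, $x_i\in\operatorname{Argmin}\big(\varphi_i+\boldsymbol{f}_i(\,\cdot\,;\boldsymbol{x}_{\smallsetminus i})+\sum_{k\in K}(g_k\circ\boldsymbol{L}_k)(\,\cdot\,;\boldsymbol{x}_{\smallsetminus i})\big)$, where $\operatorname{Argmin}$ is the set of global minimizers over $\mathcal{H}_i$. **Further notation.** Let $\mathcal{H}$ be a real Hilbert space. For $\varphi\in\Gamma_0(\mathcal{H})$: $\partial\varphi(x)=\{x^*\in\mathcal{H}\mid(\forall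 y\in\mathcal{H})\ \langle y-x\mid x^*\rangle+\varphi(x)\leq\varphi(y)\}$ is the subdifferential, a set-valued operator from $\mathcal{H}$ to $2^{\mathcal{H}}$; it is surjective if its range $\bigcup_{x}\partial\varphi(x)$ is $\mathcal{H}$. $\varphi^*$ is the Fenchel conjugate. $\varphi$ is supercoercive if $\lim_{\|x\|\to+\infty}\varphi(x)/\|x\|=+\infty$. $\varphi$ is uniformly convex if there exists an increasing function $\phi\colon[0,+\infty[\,\to[0,+\infty]$ that vanishes only at $0$ such that, for all $x,y\in\operatorname{dom}\varphi$ and all $\alpha\in\,]0,1[$, $\varphi(\alpha x+(1-\alpha)y)+\alpha(1-\alpha)\phi(\|x-y\|)\leq\alpha\varphi(x)+(1-\alpha)\varphi(y)$. A monotone operator $A\colon\mathcal{H}\to2^{\mathcal{H}}$ with domain $\operatorname{dom}A=\{x\mid Ax\neq\varnothing\}$, range $\operatorname{ran}A=\bigcup_{x\in\operatorname{dom}A}Ax$, and graph $\operatorname{gra}A=\{(x,x^* )\mid x^*\in Ax\}$ is $3^*$ monotone if, for every $x\in\operatorname{dom}A$ and every $x^*\in\operatorname{ran}A$, $\sup_{(y,y^* )\in\operatorname{gra}A}\langle x-y\mid y^*-x^*\rangle<+\infty$. (Single-valued operators are identified with set-valued operators with singleton values.) The strong relative interior of a nonempty convex set $C\subset\mathcal{H}$ is $\operatorname{sri}C=\{x\in C\mid\bigcup_{\lambda\in]0,+\infty[}\lambda(C-x)\text{ is a closed vector subspace of }\mathcal{H}\}$. $\boldsymbol{L}_k^*$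 denotes the adjoint of $\boldsymbol{L}_k$. *)

theory Defs
  imports "HOL-Analysis.Analysis"
begin

text \<open>
  A finite family of (different) real Hilbert spaces is given by closed subspaces
  \<open>S j\<close> of one Hilbert space, i.e. of a type of sort \<open>{real_inner, banach}\<close>.
  Up to isometry every finite family is of this form, the ambient space being the direct
  sum of the family. All notions below are therefore relative to a closed subspace \<open>V\<close>
  playing the role of the whole space: functions and operators are only looked at on \<open>V\<close>.
\<close>

definition hilbert_subspace :: "'a::{real_inner,banach} set \<Rightarrow> bool" where
  "hilbert_subspace V \<longleftrightarrow> subspace V \<and> closed V"

text \<open>
  Elements of the Hilbert direct sum of \<open>(S j)\<close>, \<open>j \<in> J\<close>, are vectors whose entries outside
  the index set \<open>J\<close> are \<open>0\<close>; the inner product of the type of vectors is then the sum over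
  \<open>J\<close> of the inner products of the components.
\<close>

definition hilbert_sum :: "'j set \<Rightarrow> ('j \<Rightarrow> 'a set) \<Rightarrow> (('a::{real_inner,banach}) ^ 'j::finite) set"
  where "hilbert_sum J S = {x. (\<forall>j\<in>J. x $ j \<in> S j) \<and> (\<forall>j. j \<notin> J \<longrightarrow> x $ j = 0)}"

text \<open>\<open>(u; y\<^sub>-\<^sub>i)\<close>: the \<open>i\<close>-th component of \<open>y\<close> is replaced by \<open>u\<close>.\<close>

definition replace_comp :: "'i \<Rightarrow> 'a \<Rightarrow> 'a ^ 'i \<Rightarrow> 'a ^ 'i::finite" where
  "replace_comp i u y = (\<chi> j. if j = i then u else y $ j)"


subsection \<open>Extended-real-valued convex functions on \<open>V\<close>\<close>

definition eff_dom :: "'a set \<Rightarrow> ('a \<Rightarrow> ereal) \<Rightarrow> 'a set" where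
  "eff_dom V \<phi> = {x \<in> V. \<phi> x < \<infinity>}"

definition Gamma0 :: "'a::{real_inner,banach} set \<Rightarrow> ('a \<Rightarrow> ereal) \<Rightarrow> bool" where
  "Gamma0 V \<phi> \<longleftrightarrow>
     (\<forall>x\<in>V. \<phi> x \<noteq> -\<infinity>) \<and>
     eff_dom V \<phi> \<noteq> {} \<and>
     (\<forall>x\<in>V. \<forall>y\<in>V. \<forall>\<alpha>\<in>{0<..<1}.
        \<phi> (\<alpha> *\<^sub>R x + (1 - \<alpha>) *\<^sub>R y) \<le> ereal \<alpha> * \<phi> x + ereal (1 - \<alpha>) * \<phi> y) \<and>
     (\<forall>x\<in>V. \<phi> x \<le> Liminf (at x within V) \<phi>)"

definition subdiff :: "'a::{real_inner,banach} set \<Rightarrow> ('a \<Rightarrow> ereal) \<Rightarrow> 'a \<Rightarrow> 'a set" where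
  "subdiff V \<phi> x =
     {u. x \<in> V \<and> u \<in> V \<and> (\<forall>y\<in>V. ereal ((y - x) \<bullet> u) + \<phi> x \<le> \<phi> y)}"

definition fenchel_conj :: "'a::{real_inner,banach} set \<Rightarrow> ('a \<Rightarrow> ereal) \<Rightarrow> 'a \<Rightarrow> ereal" where
  "fenchel_conj V \<phi> u = (SUP x\<in>V. ereal (x \<bullet> u) - \<phi> x)"

definition supercoercive :: "'a::{real_inner,banach} set \<Rightarrow> ('a \<Rightarrow> ereal) \<Rightarrow> bool" where
  "supercoercive V \<phi> \<longleftrightarrow>
     ((\<lambda>x. \<phi> x / ereal (norm x)) \<longlongrightarrow> \<infinity>) (inf at_infinity (principal V))"

definition uniformly_convex :: "'a::{real_inner,banach} set \<Rightarrow> ('a \<Rightarrow> ereal) \<Rightarrow> bool" where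
  "uniformly_convex V \<phi> \<longleftrightarrow>
     (\<exists>\<theta> :: real \<Rightarrow> ereal. mono_on {0..} \<theta> \<and> (\<forall>t\<ge>0. 0 \<le> \<theta> t \<and> (\<theta> t = 0 \<longleftrightarrow> t = 0)) \<and>
        (\<forall>x\<in>eff_dom V \<phi>. \<forall>y\<in>eff_dom V \<phi>. \<forall>\<alpha>\<in>{0<..<1}.
           \<phi> (\<alpha> *\<^sub>R x + (1 - \<alpha>) *\<^sub>R y) + ereal (\<alpha> * (1 - \<alpha>)) * \<theta> (norm (x - y))
             \<le> ereal \<alpha> * \<phi> x + ereal (1 - \<alpha>) * \<phi> y))"

definition Argmin :: "'a set \<Rightarrow> ('a \<Rightarrow> ereal) \<Rightarrow> 'a set" where
  "Argmin V h = {x. is_arg_min h (\<lambda>y. y \<in> V) x}"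


subsection \<open>Set-valued operators\<close>

definition op_dom :: "('a \<Rightarrow> 'b set) \<Rightarrow> 'a set" where
  "op_dom A = {x. A x \<noteq> {}}"

definition op_ran :: "('a \<Rightarrow> 'b set) \<Rightarrow> 'b set" where
  "op_ran A = (\<Union>x\<in>op_dom A. A x)"

definition op_gra :: "('a \<Rightarrow> 'b set) \<Rightarrow> ('a \<times> 'b) set" where
  "op_gra A = {(x, u). u \<in> A x}"

definition monotone_op :: "('a::real_inner \<Rightarrow> 'a set) \<Rightarrow> bool" where
  "monotone_op A \<longleftrightarrow> (\<forall>(x, u)\<in>op_gra A. \<forall>(y, v)\<in>op_gra A. 0 \<le> (x - y) \<bullet> (u - v))"

definition three_star_monotone :: "('a::real_inner \<Rightarrow> 'a set) \<Rightarrow> bool" where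
  "three_star_monotone A \<longleftrightarrow> monotone_op A \<and>
     (\<forall>x\<in>op_dom A. \<forall>u\<in>op_ran A.
        (SUP (y, v)\<in>op_gra A. ereal ((x - y) \<bullet> (v - u))) < \<infinity>)"

text \<open>A single-valued operator on \<open>V\<close>, viewed as a set-valued one.\<close>

definition sv_op :: "'a set \<Rightarrow> ('a \<Rightarrow> 'b) \<Rightarrow> 'a \<Rightarrow> 'b set" where
  "sv_op V T x = (if x \<in> V then {T x} else {})"


subsection \<open>Linear operators and the strong relative interior\<close>

definition bounded_linear_between ::
    "'a::{real_inner,banach} set \<Rightarrow> 'b::{real_inner,banach} set \<Rightarrow> ('a \<Rightarrow> 'b) \<Rightarrow> bool" where
  "bounded_linear_between V W L \<longleftrightarrow>
     L \<in> V \<rightarrow> W \<and>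
     (\<forall>x\<in>V. \<forall>y\<in>V. L (x + y) = L x + L y) \<and>
     (\<forall>x\<in>V. \<forall>c. L (c *\<^sub>R x) = c *\<^sub>R L x) \<and>
     (\<exists>B. \<forall>x\<in>V. norm (L x) \<le> B * norm x)"

definition adjoint_between ::
    "'a::{real_inner,banach} set \<Rightarrow> ('a \<Rightarrow> 'b::{real_inner,banach}) \<Rightarrow> 'b \<Rightarrow> 'a" where
  "adjoint_between V L v = (THE u. u \<in> V \<and> (\<forall>x\<in>V. L x \<bullet> v = x \<bullet> u))"

text \<open>For \<open>C \<subseteq> V\<close> with \<open>V\<close> a closed subspace, being closed in \<open>V\<close> and in the type agree.\<close>

definition sri :: "'a::{real_inner,banach} set \<Rightarrow> 'a set" where
  "sri C = {x \<in> C. hilbert_subspace (\<Union>r\<in>{0<..}. (\<lambda>c. r *\<^sub>R (c - x)) ` C)}"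


subsection \<open>The Nash equilibrium problem\<close>

text \<open>
  The gradient of \<open>f\<^sub>i(\<cdot>; x\<^sub>-\<^sub>i)\<close> at \<open>x\<^sub>i\<close> in the Hilbert space \<open>H i\<close>: the Riesz representative,
  in \<open>H i\<close>, of the derivative along \<open>H i\<close>.
\<close>

definition partial_gradient ::
    "('i \<Rightarrow> 'a set) \<Rightarrow> ('i \<Rightarrow> ('a::{real_inner,banach}) ^ 'i \<Rightarrow> real) \<Rightarrow> 'i \<Rightarrow> 'a ^ 'i::finite \<Rightarrow> 'a"
  where
  "partial_gradient H f i x =
     (THE D. D \<in> H i \<and>
        ((\<lambda>u. f i (replace_comp i u x)) has_derivative (\<lambda>h. h \<bullet> D)) (at (x $ i) within H i))"

definition pseudo_gradient ::
    "('i \<Rightarrow> 'a set) \<Rightarrow> ('i \<Rightarrow> ('a::{real_inner,banach}) ^ 'i \<Rightarrow> real) \<Rightarrow> 'a ^ 'i::finite \<Rightarrow> 'a ^ 'i"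
  where "pseudo_gradient H f x = (\<chi> i. partial_gradient H f i x)"

text \<open>In the next two definitions the index set \<open>I\<close> of the players is the finite type \<open>'i\<close>.\<close>

definition qualification_set ::
    "('i::finite \<Rightarrow> 'a set) \<Rightarrow> ('i \<Rightarrow> 'a \<Rightarrow> ereal) \<Rightarrow> 'k set \<Rightarrow> ('k \<Rightarrow> 'b set) \<Rightarrow>
     ('k \<Rightarrow> 'b \<Rightarrow> ereal) \<Rightarrow> ('k \<Rightarrow> ('a::{real_inner,banach}) ^ 'i \<Rightarrow> 'b) \<Rightarrow>
     (('b::{real_inner,banach}) ^ 'k::finite) set"
  where
  "qualification_set H \<phi> K G g L =
     {(\<chi> k. if k \<in> K then L k x - y k else 0) | x y.
        (\<forall>i. x $ i \<in> eff_dom (H i) (\<phi> i)) \<and> (\<forall>k\<in>K. y k \<in> eff_dom (G k) (g k))}"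

definition primal_dual_set ::
    "('i::finite \<Rightarrow> 'a set) \<Rightarrow> ('i \<Rightarrow> 'a \<Rightarrow> ereal) \<Rightarrow> ('i \<Rightarrow> 'a ^ 'i \<Rightarrow> real) \<Rightarrow>
     'k set \<Rightarrow> ('k \<Rightarrow> 'b set) \<Rightarrow> ('k \<Rightarrow> 'b \<Rightarrow> ereal) \<Rightarrow>
     ('k \<Rightarrow> ('a::{real_inner,banach}) ^ 'i \<Rightarrow> 'b) \<Rightarrow>
     (('a ^ 'i) \<times> (('b::{real_inner,banach}) ^ 'k::finite)) set"
  where
  "primal_dual_set H \<phi> f K G g L =
     {(x, v). x \<in> hilbert_sum UNIV H \<and> v \<in> hilbert_sum K G \<and>
        (\<forall>i. - partial_gradient H f i x
                - (\<Sum>k\<in>K. adjoint_between (hilbert_sum UNIV H) (L k) (v $ k) $ i)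
              \<in> subdiff (H i) (\<phi> i) (x $ i)) \<and>
        (\<forall>k\<in>K. L k x \<in> subdiff (G k) (fenchel_conj (G k) (g k)) (v $ k))}"

end

theory Submission
  imports Defs
begin

text \<open>
  Write \<open>F\<close> for the sum of the \<open>\<phi>\<^sub>i\<close>, \<open>\<Psi>\<close> for the sum of the \<open>g\<^sub>k\<close>, \<open>B\<close> for the pseudogradient and \<open>L\<close> for
  the joint linear operator. A point of the primal-dual set is a pair \<open>(x, v)\<close> with
  \<open>- B x - L\<^sup>* v \<in> \<partial>F(x)\<close> and \<open>v \<in> \<partial>\<Psi>(L x)\<close>. Such a pair yields an equilibrium: for each player, the
  subgradient inequalities of \<open>\<phi>\<^sub>i\<close> and of the \<open>g\<^sub>k\<close> and the gradient inequality of the convex function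
  \<open>f\<^sub>i(\<cdot>; x\<^sub>-\<^sub>i)\<close> have slopes that cancel. So everything rests on the existence of \<open>(x, v)\<close>.

  The pair is obtained in one limit process that produces the point and the multiplier
  simultaneously. With a copy \<open>y\<close> of \<open>L x\<close>, the penalized and regularized problem
    \<open>0 \<in> \<partial>(F + \<Psi>)(x, y) + (B x, 0) + R\<^sup>*R (x, y) / \<epsilon> + \<epsilon> ((x, y) - (x\<^sub>0, L x\<^sub>0))\<close>,
  where \<open>R (x, y) = L x - y\<close> and where the qualification condition supplies \<open>x\<^sub>0\<close> in the domain of \<open>F\<close>
  with \<open>L x\<^sub>0\<close> in the domain of \<open>\<Psi>\<close>, has a solution by a contraction argument
  (\<open>strongly_monotone_vi_solution\<close>). As \<open>\<epsilon>\<close> tends to 0, the solutions stay bounded because each of the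
  two alternatives of the theorem implies that, up to constants, every linear function is a minorant of
  \<open>F x + (x - x\<^sub>0) \<bullet> B x\<close>: under the first one, \<open>F\<close> itself has
  affine minorants of every slope (\<open>affine_minorant_every_slope\<close>) and \<open>B\<close> is monotone; under the second
  one, the \<open>3\<^sup>*\<close> property and surjectivity of \<open>B\<close> provide every slope. The approximate multipliers
  \<open>R (x, y) / \<epsilon>\<close> stay bounded because they lie in the cone generated by the qualification set, their
  pairings with each element of this cone are bounded on one side, and the cone is a closed
  subspace. Both bounds come from the uniform boundedness principle
  (\<open>bounded_if_pointwise_bounded_above\<close>).

  In its Minty form the variational inequality is a family of closed convex conditions on the point
  and the multiplier, so a point common to the closed convex hulls of all tails
  (\<open>bounded_sequence_common_point\<close>) satisfies it. This limit argument is
  \<open>vi_lagrange_multiplier\<close>, and \<open>vi_composite_multiplier\<close> specializes it to the splitting \<open>y = L x\<close>.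
\<close>

section \<open>Closed convex functions on a subset\<close>

text \<open>
  A proper lower semicontinuous convex function is handled as a pair of its effective domain
  \<open>D\<close> and a real-valued function on \<open>D\<close>. Closedness of the epigraph carries the whole lower
  semicontinuity, including the behaviour at boundary points of \<open>D\<close> where the function is
  infinite, and it keeps all estimates inside the reals.
\<close>

definition closed_convex_fun :: "'a::real_normed_vector set \<Rightarrow> ('a \<Rightarrow> real) \<Rightarrow> bool" where
  "closed_convex_fun D h \<longleftrightarrow> D \<noteq> {} \<and> convex_on D h \<and> closed (epigraph D h)"

lemma closed_epigraph_limit:
  assumes "closed (epigraph D h)" "\<And>n. x n \<in> D" "\<And>n. h (x n) \<le> t n"
    and "x \<longlonglongrightarrow> x'" "t \<longlonglongrightarrow> t'"
  shows "x' \<in> D \<and> h x' \<le> t'"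
proof -
  have lim: "(\<lambda>n. (x n, t n)) \<longlonglongrightarrow> (x', t')"
    using assms by (intro tendsto_Pair)
  have mem: "(x n, t n) \<in> epigraph D h" for n
    using assms(2,3) by (simp add: mem_epigraph)
  have "(x', t') \<in> epigraph D h"
    by (rule closed_sequentially[OF assms(1) mem lim])
  then show ?thesis by (simp add: mem_epigraph)
qed

lemma closed_epigraph_eventually_gt:
  assumes "closed (epigraph D h)" "\<not> (x \<in> D \<and> h x \<le> s)"
  shows "\<forall>\<^sub>F y in nhds x. y \<in> D \<longrightarrow> s < h y"
proof -
  have "open ((\<lambda>y. (y, s)) -` (- epigraph D h))"
    using assms(1) by (intro open_vimage open_Compl continuous_intros)
  moreover have "x \<in> (\<lambda>y. (y, s)) -` (- epigraph D h)"
    using assms(2) by (simp add: mem_epigraph)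
  ultimately show ?thesis
    unfolding eventually_nhds
    by (intro exI[of _ "(\<lambda>y. (y, s)) -` (- epigraph D h)"]) (auto simp: mem_epigraph)
qed

text \<open>
  If a limit \<open>(x, t)\<close> of points of the epigraph lay outside it, there would be levels \<open>s\<close> and \<open>r\<close>
  with \<open>t < s + r\<close> that neither summand undercuts near \<open>x\<close>. Outside a domain the level may be
  taken arbitrarily high, which settles the points at which one of the summands is infinite.
\<close>

lemma closed_epigraph_add:
  fixes f h :: "'a::metric_space \<Rightarrow> real"
  assumes f: "closed (epigraph D f)" and h: "closed (epigraph E h)"
  shows "closed (epigraph (D \<inter> E) (\<lambda>x. f x + h x))"
proof (unfold closed_sequential_limits, intro allI impI, elim conjE)
  fix z :: "nat \<Rightarrow> 'a \<times> real" and l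
  assume z: "\<forall>n. z n \<in> epigraph (D \<inter> E) (\<lambda>x. f x + h x)" and "z \<longlonglongrightarrow> l"
  obtain x t where l: "l = (x, t)" by fastforce
  have lim: "(\<lambda>n. fst (z n)) \<longlonglongrightarrow> x" "(\<lambda>n. snd (z n)) \<longlonglongrightarrow> t"
    using tendsto_fst[OF \<open>z \<longlonglongrightarrow> l\<close>] tendsto_snd[OF \<open>z \<longlonglongrightarrow> l\<close>] l by auto
  have "x \<in> D \<inter> E \<and> f x + h x \<le> t"
  proof (rule ccontr)
    assume neg: "\<not> ?thesis"
    have "\<exists>s r. \<not> (x \<in> D \<and> f x \<le> s) \<and> \<not> (x \<in> E \<and> h x \<le> r) \<and> t < s + r"
    proof (cases "x \<in> D")
      case False
      then show ?thesis
        by (intro exI[of _ "t + 1 - (h x - 1)"] exI[of _ "h x - 1"]) auto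
    next
      case xD: True
      show ?thesis
      proof (cases "x \<in> E")
        case False
        then show ?thesis
          by (intro exI[of _ "f x - 1"] exI[of _ "t + 1 - (f x - 1)"]) auto
      next
        case True
        define e where "e = (f x + h x - t) / 3"
        have "e > 0" using neg xD True by (auto simp: e_def)
        moreover have "t < f x - e + (h x - e)"
          using \<open>e > 0\<close> by (simp add: e_def field_simps)
        ultimately show ?thesis
          by (intro exI[of _ "f x - e"] exI[of _ "h x - e"]) auto
      qed
    qed
    then obtain s r where sr: "\<not> (x \<in> D \<and> f x \<le> s)" "\<not> (x \<in> E \<and> h x \<le> r)" "t < s + r"
      by blast
    have "\<forall>\<^sub>F n in sequentially. fst (z n) \<in> D \<longrightarrow> s < f (fst (z n))"
      by (rule eventually_compose_filterlim[OF closed_epigraph_eventually_gt[OF f sr(1)] lim(1)])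
    moreover have "\<forall>\<^sub>F n in sequentially. fst (z n) \<in> E \<longrightarrow> r < h (fst (z n))"
      by (rule eventually_compose_filterlim[OF closed_epigraph_eventually_gt[OF h sr(2)] lim(1)])
    moreover have "\<forall>\<^sub>F n in sequentially. snd (z n) < s + r"
      by (rule order_tendstoD(2)[OF lim(2) sr(3)])
    ultimately have "\<forall>\<^sub>F n in sequentially. False"
    proof eventually_elim
      case (elim n)
      have "z n \<in> epigraph (D \<inter> E) (\<lambda>x. f x + h x)" using z by blast
      with elim show ?case by (auto simp: epigraph_def)
    qed
    then show False by simp
  qed
  then show "l \<in> epigraph (D \<inter> E) (\<lambda>x. f x + h x)"
    by (simp add: l mem_epigraph)
qed

lemma closed_epigraph_sum:
  fixes h :: "'j \<Rightarrow> 'a::metric_space \<Rightarrow> real"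
  assumes "finite J" "\<And>j. j \<in> J \<Longrightarrow> closed (epigraph (D j) (h j))"
  shows "closed (epigraph (\<Inter>j\<in>J. D j) (\<lambda>x. \<Sum>j\<in>J. h j x))"
  using assms
proof (induction J)
  case empty
  have "epigraph UNIV (\<lambda>x::'a. 0) = UNIV \<times> {0..}"
    by (auto simp: epigraph_def)
  then show ?case by (simp add: closed_Times)
next
  case (insert j J)
  then show ?case
    using closed_epigraph_add[of "D j" "h j" "\<Inter>j\<in>J. D j" "\<lambda>x. \<Sum>j\<in>J. h j x"] by simp
qed

lemma closed_epigraph_compose:
  assumes "closed (epigraph D h)" "continuous_on UNIV \<pi>"
  shows "closed (epigraph (\<pi> -` D) (\<lambda>x. h (\<pi> x)))"
proof -
  have "epigraph (\<pi> -` D) (\<lambda>x. h (\<pi> x)) = (\<lambda>z. (\<pi> (fst z), snd z)) -` epigraph D h"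
    by (auto simp: epigraph_def)
  moreover have "continuous_on UNIV (\<lambda>z. (\<pi> (fst z), snd z) :: _ \<times> real)"
    by (intro continuous_intros continuous_on_compose2[OF assms(2)]) auto
  ultimately show ?thesis
    using assms(1) by (simp add: closed_vimage)
qed

lemma convex_on_sum_components:
  fixes h :: "'j::finite \<Rightarrow> 'a::real_vector \<Rightarrow> real"
  assumes "\<And>j. convex_on (D j) (h j)"
  shows "convex_on {x :: 'a ^ 'j. \<forall>j. x $ j \<in> D j} (\<lambda>x. \<Sum>j\<in>UNIV. h j (x $ j))"
proof (rule convex_onI)
  fix t :: real and x y :: "'a ^ 'j"
  assume "0 < t" "t < 1" "x \<in> {x. \<forall>j. x $ j \<in> D j}" "y \<in> {x. \<forall>j. x $ j \<in> D j}"
  then have "h j ((1 - t) *\<^sub>R x $ j + t *\<^sub>R y $ j) \<le> (1 - t) * h j (x $ j) + t * h j (y $ j)" for j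
    using convex_onD[OF assms, of t "x $ j" j "y $ j"] by simp
  then show "(\<Sum>j\<in>UNIV. h j (((1 - t) *\<^sub>R x + t *\<^sub>R y) $ j))
      \<le> (1 - t) * (\<Sum>j\<in>UNIV. h j (x $ j)) + t * (\<Sum>j\<in>UNIV. h j (y $ j))"
    unfolding sum_distrib_left sum.distrib[symmetric] by (intro sum_mono) simp
next
  have "convex (D j)" for j
    using assms by (auto simp: convex_on_def)
  then show "convex {x :: 'a ^ 'j. \<forall>j. x $ j \<in> D j}"
    by (auto simp: convex_def)
qed

lemma closed_convex_fun_sum_components:
  fixes h :: "'j::finite \<Rightarrow> 'a::real_normed_vector \<Rightarrow> real"
  assumes "\<And>j. closed_convex_fun (D j) (h j)"
  shows "closed_convex_fun {x :: 'a ^ 'j. \<forall>j. x $ j \<in> D j} (\<lambda>x. \<Sum>j\<in>UNIV. h j (x $ j))"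
  unfolding closed_convex_fun_def
proof (intro conjI)
  have "\<forall>j. \<exists>x. x \<in> D j"
    using assms by (auto simp: closed_convex_fun_def)
  then obtain x where "\<And>j. x j \<in> D j" by metis
  then have "(\<chi> j. x j) \<in> {x. \<forall>j. x $ j \<in> D j}" by simp
  then show "{x :: 'a ^ 'j. \<forall>j. x $ j \<in> D j} \<noteq> {}" by blast
  show "convex_on {x :: 'a ^ 'j. \<forall>j. x $ j \<in> D j} (\<lambda>x. \<Sum>j\<in>UNIV. h j (x $ j))"
    using assms by (intro convex_on_sum_components) (auto simp: closed_convex_fun_def)
  have "closed (epigraph (\<Inter>j\<in>UNIV. (\<lambda>x :: 'a ^ 'j. x $ j) -` D j) (\<lambda>x. \<Sum>j\<in>UNIV. h j (x $ j)))"
    using assms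
    by (intro closed_epigraph_sum closed_epigraph_compose continuous_on_component
        continuous_on_id finite_UNIV) (simp_all add: closed_convex_fun_def)
  moreover have "(\<Inter>j\<in>UNIV. (\<lambda>x :: 'a ^ 'j. x $ j) -` D j) = {x. \<forall>j. x $ j \<in> D j}"
    by auto
  ultimately show "closed (epigraph {x :: 'a ^ 'j. \<forall>j. x $ j \<in> D j} (\<lambda>x. \<Sum>j\<in>UNIV. h j (x $ j)))"
    by simp
qed

lemma closed_convex_fun_prod:
  fixes f :: "'a::real_normed_vector \<Rightarrow> real" and h :: "'b::real_normed_vector \<Rightarrow> real"
  assumes f: "closed_convex_fun D f" and h: "closed_convex_fun E h"
  shows "closed_convex_fun (D \<times> E) (\<lambda>z. f (fst z) + h (snd z))"
  unfolding closed_convex_fun_def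
proof (intro conjI)
  show "D \<times> E \<noteq> {}"
    using assms by (auto simp: closed_convex_fun_def)
  show "convex_on (D \<times> E) (\<lambda>z. f (fst z) + h (snd z))"
  proof (rule convex_onI)
    fix t :: real and x y
    assume t: "0 < t" "t < 1" and "x \<in> D \<times> E" "y \<in> D \<times> E"
    then have "f ((1 - t) *\<^sub>R fst x + t *\<^sub>R fst y) \<le> (1 - t) * f (fst x) + t * f (fst y)"
      "h ((1 - t) *\<^sub>R snd x + t *\<^sub>R snd y) \<le> (1 - t) * h (snd x) + t * h (snd y)"
      using f h by (intro convex_onD[of D f] convex_onD[of E h]; force simp: closed_convex_fun_def)+
    then show "f (fst ((1 - t) *\<^sub>R x + t *\<^sub>R y)) + h (snd ((1 - t) *\<^sub>R x + t *\<^sub>R y))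
        \<le> (1 - t) * (f (fst x) + h (snd x)) + t * (f (fst y) + h (snd y))"
      by (simp add: distrib_left)
  next
    show "convex (D \<times> E)"
      using f h by (intro convex_Times) (simp_all add: closed_convex_fun_def convex_on_def)
  qed
  have "closed (epigraph (fst -` D \<inter> snd -` E) (\<lambda>z. f (fst z) + h (snd z)))"
    using assms
    by (intro closed_epigraph_add closed_epigraph_compose continuous_on_fst continuous_on_snd
        continuous_on_id) (simp_all add: closed_convex_fun_def)
  moreover have "fst -` D \<inter> snd -` E = D \<times> E" by auto
  ultimately show "closed (epigraph (D \<times> E) (\<lambda>z. f (fst z) + h (snd z)))"
    by simp
qed

text \<open>
  By lower semicontinuity the function stays above \<open>h x0 - 1\<close> on a ball around a point \<open>x0\<close> of
  its domain, and convexity along rays from \<open>x0\<close> turns this local bound into a global one with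
  linear growth. It replaces the separation argument for an affine minorant, which becomes a
  consequence of the existence of proximal points.
\<close>

lemma closed_convex_fun_lower_bound:
  fixes h :: "'a::real_normed_vector \<Rightarrow> real"
  assumes "closed_convex_fun D h"
  obtains c where "c \<ge> 0" "\<And>x. x \<in> D \<Longrightarrow> - c * (1 + norm x) \<le> h x"
proof -
  obtain x0 where x0: "x0 \<in> D" using assms by (auto simp: closed_convex_fun_def)
  have "\<forall>\<^sub>F y in nhds x0. y \<in> D \<longrightarrow> h x0 - 1 < h y"
    using assms by (intro closed_epigraph_eventually_gt) (auto simp: closed_convex_fun_def)
  then obtain r where r: "r > 0" "\<And>y. dist y x0 < r \<Longrightarrow> y \<in> D \<Longrightarrow> h x0 - 1 < h y"
    unfolding eventually_nhds_metric by blast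
  define c where "c = \<bar>h x0\<bar> + 1 + 2 / r * (1 + norm x0)"
  have c0: "c \<ge> 0" using r by (simp add: c_def)
  have cr: "2 / r \<le> c" "\<bar>h x0\<bar> + 1 + 2 / r * norm x0 \<le> c"
  proof -
    have "0 \<le> 2 / r" "0 \<le> 2 / r * norm x0" using r by simp_all
    moreover have "c = \<bar>h x0\<bar> + 1 + 2 / r + 2 / r * norm x0"
      by (simp add: c_def distrib_left)
    ultimately show "2 / r \<le> c" "\<bar>h x0\<bar> + 1 + 2 / r * norm x0 \<le> c" by linarith+
  qed
  show ?thesis
  proof (rule that[OF c0])
    fix x assume x: "x \<in> D"
    have key: "h x0 - 1 - 2 / r * norm (x - x0) \<le> h x"
    proof (cases "dist x x0 < r")
      case True
      have "0 \<le> 2 / r * norm (x - x0)" using r by simp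
      with r(2)[OF True x] show ?thesis by linarith
    next
      case False
      define d where "d = norm (x - x0)"
      have d: "d \<ge> r" using False by (simp add: d_def dist_norm)
      define t where "t = r / (2 * d)"
      have t: "0 < t" "t < 1" using d r by (simp_all add: t_def)
      define y where "y = (1 - t) *\<^sub>R x0 + t *\<^sub>R x"
      have cv: "convex_on D h" using assms by (simp add: closed_convex_fun_def)
      then have "convex D" by (simp add: convex_on_def)
      then have yD: "y \<in> D" unfolding y_def using x x0 t by (intro convexD) auto
      have "y - x0 = t *\<^sub>R (x - x0)" by (simp add: y_def algebra_simps)
      then have "norm (y - x0) = t * d" using t by (simp add: d_def)
      also have "\<dots> = r / 2" using d r by (simp add: t_def)
      finally have "dist y x0 < r" using r by (simp add: dist_norm)
      then have "h x0 - 1 < h y" using r(2) yD by blast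
      also have "h y \<le> (1 - t) * h x0 + t * h x"
        unfolding y_def using t x x0 by (intro convex_onD[OF cv]) auto
      finally have "t * (h x0 - h x) < 1" by (simp add: left_diff_distrib right_diff_distrib)
      then have "h x0 - h x < 1 / t"
        using t by (simp add: pos_less_divide_eq mult.commute)
      also have "1 / t = 2 / r * d" by (simp add: t_def)
      finally have "h x0 - h x < 2 / r * d" .
      then show ?thesis by (simp add: d_def)
    qed
    have "2 / r * norm (x - x0) \<le> 2 / r * (norm x + norm x0)"
      using r norm_triangle_ineq4[of x x0] by (intro mult_left_mono) auto
    moreover have "2 / r * norm x \<le> c * norm x"
      using cr(1) by (rule mult_right_mono) simp
    ultimately show "- c * (1 + norm x) \<le> h x"
      using key cr(2) by (simp add: distrib_left)
  qed
qed

section \<open>Proximal points and strongly monotone variational inequalities\<close>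

text \<open>
  The passage from a minimality condition along a segment to a first-order condition.
\<close>

lemma nonneg_if_nonneg_perturbed:
  fixes A B :: real
  assumes "\<And>t. 0 < t \<Longrightarrow> t < 1 \<Longrightarrow> 0 \<le> A + t * B"
  shows "0 \<le> A"
proof -
  have "((\<lambda>t. A + t * B) \<longlongrightarrow> A + 0 * B) (at_right 0)"
    by (intro tendsto_intros)
  moreover have "\<forall>\<^sub>F t in at_right 0. 0 \<le> A + t * B"
    unfolding eventually_at_right_field using assms by (intro exI[of _ 1]) auto
  ultimately show ?thesis
    using tendsto_lowerbound[of "\<lambda>t. A + t * B" "A + 0 * B" "at_right 0" 0] by simp
qed

lemma closed_convex_fun_cmult:
  fixes h :: "'a::real_normed_vector \<Rightarrow> real"
  assumes "closed_convex_fun D h" "0 < c"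
  shows "closed_convex_fun D (\<lambda>x. c * h x)"
proof -
  have "epigraph D (\<lambda>x. c * h x) = (\<lambda>z. (fst z, snd z / c)) -` epigraph D h"
    using assms(2) by (auto simp: epigraph_def field_simps)
  moreover have "continuous_on UNIV (\<lambda>z :: 'a \<times> real. (fst z, snd z / c))"
    using assms(2) by (intro continuous_intros) auto
  ultimately have "closed (epigraph D (\<lambda>x. c * h x))"
    using assms(1) by (simp add: closed_vimage closed_convex_fun_def)
  then show ?thesis
    using assms convex_on_cmul[of c D h] by (simp add: closed_convex_fun_def)
qed

text \<open>
  Minimizing \<open>h x + (norm (x - z))\<^sup>2 / 2\<close>: by strong convexity, minimizing sequences are Cauchy, so
  completeness replaces compactness. The subgradient inequality at the minimizer is kept as
  the conclusion; it yields projections, affine minorants and the Riesz representation below.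
\<close>

lemma proximal_point_exists:
  fixes h :: "'a::{real_inner,banach} \<Rightarrow> real"
  assumes h: "closed_convex_fun D h"
  obtains p where "p \<in> D" "\<And>y. y \<in> D \<Longrightarrow> (y - p) \<bullet> (z - p) + h p \<le> h y"
proof -
  define J where "J x = h x + (norm (x - z))\<^sup>2 / 2" for x
  have cv: "convex_on D h" and cl: "closed (epigraph D h)" and ne: "D \<noteq> {}"
    using h by (auto simp: closed_convex_fun_def)
  have "convex D" using cv by (simp add: convex_on_def)
  obtain c where c: "c \<ge> 0" "\<And>x. x \<in> D \<Longrightarrow> - c * (1 + norm x) \<le> h x"
    using closed_convex_fun_lower_bound[OF h] by blast
  have "- c * (1 + norm z) - c\<^sup>2 / 2 \<le> J x" if "x \<in> D" for x
  proof -
    have "c * norm x \<le> c * (norm (x - z) + norm z)"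
      using c(1) norm_triangle_sub[of x z] by (intro mult_left_mono) auto
    moreover have "0 \<le> (norm (x - z) - c)\<^sup>2" by simp
    then have "2 * (c * norm (x - z)) \<le> (norm (x - z))\<^sup>2 + c\<^sup>2"
      by (simp add: power2_diff mult.commute mult.left_commute)
    ultimately show ?thesis
      using c(2)[OF that] by (simp add: J_def distrib_left)
  qed
  then have bdd: "bdd_below (J ` D)" by (intro bdd_belowI2)
  define m where "m = Inf (J ` D)"
  have m: "m \<le> J x" if "x \<in> D" for x
    unfolding m_def using bdd that by (simp add: cInf_lower)
  have "\<exists>x\<in>D. J x < m + 1 / real (Suc n)" for n
  proof -
    have "Inf (J ` D) < m + 1 / real (Suc n)" by (simp add: m_def)
    then show ?thesis using ne bdd by (subst (asm) cInf_less_iff) auto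
  qed
  then obtain x where x: "\<And>n. x n \<in> D" "\<And>n. J (x n) < m + 1 / real (Suc n)"
    by metis
  have mid: "(norm (a - b))\<^sup>2 \<le> 4 * (J a - m) + 4 * (J b - m)" if ab: "a \<in> D" "b \<in> D" for a b
  proof -
    define q where "q = (1 - 1/2) *\<^sub>R a + (1/2) *\<^sub>R b"
    have "q \<in> D" unfolding q_def using ab \<open>convex D\<close> by (intro convexD) auto
    moreover have "h q \<le> (1 - 1/2) * h a + 1/2 * h b"
      unfolding q_def using ab by (intro convex_onD[OF cv]) auto
    moreover have "(norm (q - z))\<^sup>2 = (norm (a - z))\<^sup>2 / 2 + (norm (b - z))\<^sup>2 / 2 - (norm (a - b))\<^sup>2 / 4"
      by (simp add: q_def power2_norm_eq_inner inner_commute algebra_simps)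
        (simp add: field_simps)
    ultimately show ?thesis using m[of q] by (simp add: J_def field_simps)
  qed
  have "Cauchy x"
  proof (rule metric_CauchyI)
    fix e :: real assume e: "e > 0"
    obtain N where N: "8 / e\<^sup>2 < real N" using reals_Archimedean2 by blast
    have "dist (x n) (x k) < e" if "n \<ge> N" "k \<ge> N" for n k
    proof -
      have "1 / real (Suc n) \<le> 1 / real (Suc N)" "1 / real (Suc k) \<le> 1 / real (Suc N)"
        using that by (auto intro!: divide_left_mono)
      then have "(norm (x n - x k))\<^sup>2 < 8 / real (Suc N)"
        using mid[OF x(1) x(1), of n k] x(2)[of n] x(2)[of k] by simp
      also have "\<dots> < e\<^sup>2"
      proof -
        have "8 / e\<^sup>2 < real (Suc N)" using N by simp
        then show ?thesis using e by (simp add: field_simps)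
      qed
      finally show ?thesis using e by (simp add: dist_norm power2_less_imp_less)
    qed
    then show "\<exists>M. \<forall>m\<ge>M. \<forall>n\<ge>M. dist (x m) (x n) < e" by blast
  qed
  then obtain p where p: "x \<longlonglongrightarrow> p"
    using Cauchy_convergent convergent_def by blast
  define r where "r n = m + 1 / real (Suc n) - (norm (x n - z))\<^sup>2 / 2" for n
  have "r \<longlonglongrightarrow> m + 0 - (norm (p - z))\<^sup>2 / 2"
    unfolding r_def using LIMSEQ_Suc[OF lim_1_over_n]
    by (intro tendsto_intros p) auto
  moreover have "h (x n) \<le> r n" for n
    using x(2)[of n] by (simp add: r_def J_def)
  ultimately have *: "p \<in> D \<and> h p \<le> m + 0 - (norm (p - z))\<^sup>2 / 2"
    using closed_epigraph_limit[OF cl x(1) _ p] by blast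
  show ?thesis
  proof (rule that)
    show pD: "p \<in> D" using * by simp
    fix y assume y: "y \<in> D"
    have "0 \<le> (h y - h p + (y - p) \<bullet> (p - z)) + t * ((norm (y - p))\<^sup>2 / 2)"
      if t: "0 < t" "t < 1" for t
    proof -
      define q where "q = (1 - t) *\<^sub>R p + t *\<^sub>R y"
      have qD: "q \<in> D" unfolding q_def using y pD t \<open>convex D\<close> by (intro convexD) auto
      have hq: "h q \<le> (1 - t) * h p + t * h y"
        unfolding q_def using y pD t by (intro convex_onD[OF cv]) auto
      have q: "q - z = (p - z) + t *\<^sub>R (y - p)" by (simp add: q_def algebra_simps)
      have "(norm (q - z))\<^sup>2 = (norm (p - z))\<^sup>2 + 2 * t * ((y - p) \<bullet> (p - z)) + t\<^sup>2 * (norm (y - p))\<^sup>2"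
        unfolding q power2_norm_eq_inner
        by (simp add: inner_add_left inner_add_right inner_commute power2_eq_square)
      with m[OF qD] hq * have "0 \<le> t * ((h y - h p + (y - p) \<bullet> (p - z)) + t * ((norm (y - p))\<^sup>2 / 2))"
        by (simp add: J_def algebra_simps power2_eq_square)
      then show ?thesis using t by (simp add: zero_le_mult_iff)
    qed
    then have "0 \<le> h y - h p + (y - p) \<bullet> (p - z)" by (rule nonneg_if_nonneg_perturbed)
    then show "(y - p) \<bullet> (z - p) + h p \<le> h y" by (simp add: inner_diff_right)
  qed
qed

text \<open>
  The inclusion \<open>0 \<in> \<partial>h(x) + T x\<close> says that \<open>x\<close> is a fixed point of a forward step along
  \<open>- T\<close> followed by the proximal map of \<open>\<gamma> h\<close>. The proximal map is nonexpansive, and strong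
  monotonicity makes the forward step a contraction when the step size \<open>\<gamma>\<close> is small.
\<close>

lemma strongly_monotone_vi_solution:
  fixes h :: "'a::{real_inner,banach} \<Rightarrow> real" and T :: "'a \<Rightarrow> 'a"
  assumes U: "hilbert_subspace U" and h: "closed_convex_fun D h" and DU: "D \<subseteq> U"
    and T: "\<And>x. x \<in> U \<Longrightarrow> T x \<in> U" and lip: "lipschitz_on M U T"
    and m: "m > 0" and mono: "\<And>x y. x \<in> U \<Longrightarrow> y \<in> U \<Longrightarrow> m * (norm (x - y))\<^sup>2 \<le> (x - y) \<bullet> (T x - T y)"
  obtains x where "x \<in> D" "\<And>y. y \<in> D \<Longrightarrow> h x + (x - y) \<bullet> T x \<le> h y"
proof -
  (* Enlarging the Lipschitz constant to N > 0 with m \<le> N makes the contraction factor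
     sqrt (1 - m^2 / N^2) meaningful; gamma = m / N^2 minimizes it. *)
  define N where "N = M + m"
  have M: "0 \<le> M" "\<And>x y. x \<in> U \<Longrightarrow> y \<in> U \<Longrightarrow> norm (T x - T y) \<le> M * norm (x - y)"
    using lip by (auto simp: lipschitz_on_def dist_norm)
  have N: "N > 0" "m \<le> N" using M m by (auto simp: N_def)
  define \<gamma> where "\<gamma> = m / N\<^sup>2"
  have \<gamma>: "\<gamma> > 0" using m N by (simp add: \<gamma>_def)
  have "\<exists>p. p \<in> D \<and> (\<forall>y\<in>D. (y - p) \<bullet> (z - p) + \<gamma> * h p \<le> \<gamma> * h y)" for z
    using proximal_point_exists[OF closed_convex_fun_cmult[OF h \<gamma>], of z] by metis
  then obtain P where P: "\<And>z. P z \<in> D"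
    "\<And>z y. y \<in> D \<Longrightarrow> (y - P z) \<bullet> (z - P z) + \<gamma> * h (P z) \<le> \<gamma> * h y"
    by metis
  have nonexp: "norm (P w - P z) \<le> norm (w - z)" for w z
  proof -
    have "(norm (P w - P z))\<^sup>2 \<le> (P w - P z) \<bullet> (w - z)"
      using P(2)[OF P(1), of w z] P(2)[OF P(1), of z w]
      by (simp add: power2_norm_eq_inner inner_diff_left inner_diff_right inner_commute)
    also have "\<dots> \<le> norm (P w - P z) * norm (w - z)" by (rule norm_cauchy_schwarz)
    finally show ?thesis
      by (cases "norm (P w - P z) = 0") (auto simp: power2_eq_square)
  qed
  define q where "q = sqrt (1 - m\<^sup>2 / N\<^sup>2)"
  have mN: "m\<^sup>2 / N\<^sup>2 \<le> 1" using N m by (simp add: power_mono)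
  have q: "0 \<le> q" "q < 1" using N m mN by (auto simp: q_def)
  have contr: "norm ((x - \<gamma> *\<^sub>R T x) - (y - \<gamma> *\<^sub>R T y)) \<le> q * norm (x - y)"
    if xy: "x \<in> U" "y \<in> U" for x y
  proof (rule power2_le_imp_le)
    define d e where "d = x - y" and "e = T x - T y"
    have "norm e \<le> N * norm d"
      using M(2)[OF xy] m by (simp add: N_def d_def e_def distrib_right add_increasing2)
    then have "(norm e)\<^sup>2 \<le> N\<^sup>2 * (norm d)\<^sup>2"
      by (metis norm_ge_zero power_mono power_mult_distrib)
    then have "\<gamma>\<^sup>2 * (norm e)\<^sup>2 \<le> \<gamma>\<^sup>2 * (N\<^sup>2 * (norm d)\<^sup>2)" by (intro mult_left_mono) auto
    moreover have "\<gamma> * (m * (norm d)\<^sup>2) \<le> \<gamma> * (d \<bullet> e)"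
      using mono[OF xy] \<gamma> by (intro mult_left_mono) (auto simp: d_def e_def)
    moreover have "(norm (d - \<gamma> *\<^sub>R e))\<^sup>2 = (norm d)\<^sup>2 - 2 * (\<gamma> * (d \<bullet> e)) + \<gamma>\<^sup>2 * (norm e)\<^sup>2"
      unfolding power2_norm_eq_inner
      by (simp add: inner_diff_left inner_diff_right inner_commute power2_eq_square)
    moreover have "\<gamma>\<^sup>2 * (N\<^sup>2 * (norm d)\<^sup>2) = m\<^sup>2 / N\<^sup>2 * (norm d)\<^sup>2"
      "\<gamma> * (m * (norm d)\<^sup>2) = m\<^sup>2 / N\<^sup>2 * (norm d)\<^sup>2"
      using N by (simp_all add: \<gamma>_def power2_eq_square)
    ultimately have "(norm (d - \<gamma> *\<^sub>R e))\<^sup>2 \<le> (norm d)\<^sup>2 - m\<^sup>2 / N\<^sup>2 * (norm d)\<^sup>2" by linarith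
    also have "\<dots> = (q * norm d)\<^sup>2"
      using mN by (simp add: q_def power_mult_distrib left_diff_distrib)
    also have "d - \<gamma> *\<^sub>R e = (x - \<gamma> *\<^sub>R T x) - (y - \<gamma> *\<^sub>R T y)"
      by (simp add: d_def e_def algebra_simps)
    finally show "(norm ((x - \<gamma> *\<^sub>R T x) - (y - \<gamma> *\<^sub>R T y)))\<^sup>2 \<le> (q * norm (x - y))\<^sup>2"
      by (simp add: d_def)
  qed (use q in simp)
  have "\<exists>!x\<in>U. P (x - \<gamma> *\<^sub>R T x) = x"
  proof (rule Banach_fix[OF _ _ q])
    show "complete U" using U by (simp add: hilbert_subspace_def complete_eq_closed)
    show "U \<noteq> {}" using P(1) DU by blast
    show "(\<lambda>x. P (x - \<gamma> *\<^sub>R T x)) ` U \<subseteq> U" using P(1) DU by blast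
    show "dist (P (x - \<gamma> *\<^sub>R T x)) (P (y - \<gamma> *\<^sub>R T y)) \<le> q * dist x y" if "x \<in> U" "y \<in> U" for x y
      using order_trans[OF nonexp contr] that by (simp add: dist_norm)
  qed
  then obtain x where x: "x \<in> U" "P (x - \<gamma> *\<^sub>R T x) = x" by blast
  show ?thesis
  proof (rule that)
    show "x \<in> D" using P(1) x(2) by metis
    fix y assume "y \<in> D"
    from P(2)[OF this, of "x - \<gamma> *\<^sub>R T x"] have "\<gamma> * (h x + (x - y) \<bullet> T x) \<le> \<gamma> * h y"
      unfolding x(2) by (simp add: inner_diff_left inner_diff_right algebra_simps)
    then show "h x + (x - y) \<bullet> T x \<le> h y" using \<gamma> by simp
  qed
qed

section \<open>Bounded families in Hilbert spaces\<close>

text \<open>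
  Uniform boundedness in a closed subspace, by the gliding hump. Were \<open>X\<close> unbounded, one could
  choose \<open>v n \<in> X\<close> with norm above \<open>n * 3 ^ n\<close> and move from \<open>x n\<close> by \<open>1 / 3 ^ (n + 1)\<close> in the
  direction of \<open>v (n + 1)\<close>, with the sign that enlarges the pairing. All later moves together
  undo at most half of that gain, so the pairings with the limit are unbounded. One-sided bounds
  suffice because they are also available at the opposite vector.
\<close>

lemma bounded_if_pointwise_bounded_above:
  fixes S X :: "'a::{real_inner,banach} set"
  assumes S: "hilbert_subspace S" and X: "X \<subseteq> S"
    and pw: "\<And>u. u \<in> S \<Longrightarrow> \<exists>c. \<forall>x\<in>X. x \<bullet> u \<le> c"
  shows "bounded X"
proof (rule ccontr)
  assume "\<not> bounded X"
  then have "\<forall>n::nat. \<exists>v\<in>X. real n * 3 ^ n < norm v"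
    unfolding bounded_iff by (meson not_le)
  then obtain v where v: "\<And>n. v n \<in> X" "\<And>n. real n * 3 ^ n < norm (v n)" by metis
  define \<sigma> where "\<sigma> n x = (if 0 \<le> v n \<bullet> x then 1 else - 1 :: real)" for n x
  define x where "x = rec_nat 0 (\<lambda>n y. y + (\<sigma> (Suc n) y / (3 ^ Suc n * norm (v (Suc n)))) *\<^sub>R v (Suc n))"
  have x_Suc: "x (Suc n) = x n + (\<sigma> (Suc n) (x n) / (3 ^ Suc n * norm (v (Suc n)))) *\<^sub>R v (Suc n)" for n
    by (simp add: x_def)
  have vpos: "norm (v n) > 0" for n
    by (rule le_less_trans[OF _ v(2)[of n]]) simp
  have subS: "subspace S" using S by (simp add: hilbert_subspace_def)
  have xS: "x n \<in> S" for n
  proof (induction n)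
    case 0
    then show ?case using subspace_0[OF subS] by (simp add: x_def)
  next
    case (Suc n)
    then show ?case
      unfolding x_Suc using subS v(1) X by (intro subspace_add subspace_scale) auto
  qed
  have step: "norm (x (Suc n) - x n) = 1 / 3 ^ Suc n" for n
    using vpos[of "Suc n"] by (simp add: x_Suc \<sigma>_def)
  have large: "norm (v (Suc n)) / 3 ^ Suc n \<le> \<bar>v (Suc n) \<bullet> x (Suc n)\<bar>" for n
  proof -
    have "v (Suc n) \<bullet> x (Suc n) = v (Suc n) \<bullet> x n + \<sigma> (Suc n) (x n) * (norm (v (Suc n)) / 3 ^ Suc n)"
      using vpos[of "Suc n"] unfolding x_Suc inner_add_right inner_scaleR_right
      by (simp add: dot_square_norm power2_eq_square del: power_Suc)
    moreover have "0 \<le> norm (v (Suc n)) / 3 ^ Suc n" by simp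
    ultimately show ?thesis by (auto simp: \<sigma>_def)
  qed
  have dist_le: "norm (x (n + k) - x n) \<le> (1 / 3 ^ n - 1 / 3 ^ (n + k)) / 2" for n k
  proof (induction k)
    case (Suc k)
    have "norm (x (n + Suc k) - x n) \<le> norm (x (n + k) - x n) + norm (x (Suc (n + k)) - x (n + k))"
      by (rule order_trans[OF _ norm_triangle_ineq]) simp
    also have "\<dots> \<le> (1 / 3 ^ n - 1 / 3 ^ (n + k)) / 2 + 1 / 3 ^ Suc (n + k)"
      using Suc by (simp add: step)
    also have "\<dots> = (1 / 3 ^ n - 1 / 3 ^ (n + Suc k)) / 2"
      by (simp add: field_simps)
    finally show ?case .
  qed simp
  have dist_le': "norm (x k - x n) \<le> 1 / 3 ^ n / 2" if "n \<le> k" for n k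
  proof -
    have "norm (x k - x n) \<le> (1 / 3 ^ n - 1 / 3 ^ k) / 2"
      using dist_le[of n "k - n"] that by simp
    also have "\<dots> \<le> 1 / 3 ^ n / 2" by simp
    finally show ?thesis .
  qed
  have "Cauchy x"
  proof (rule CauchyI')
    fix e :: real assume "e > 0"
    obtain N where N: "(1 / 3) ^ N < e"
      using real_arch_pow_inv[OF \<open>e > 0\<close>, of "1/3"] by auto
    have "dist (x m) (x n) < e" if "m \<ge> N" "n > m" for m n
    proof -
      have "dist (x m) (x n) \<le> 1 / 3 ^ m / 2"
        using dist_le'[of m n] that by (simp add: dist_norm norm_minus_commute)
      also have "\<dots> \<le> (1/3) ^ m" by (simp add: power_divide divide_right_mono field_simps)
      also have "\<dots> \<le> (1/3) ^ N" using that by (intro power_decreasing) auto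
      finally show ?thesis using N by simp
    qed
    then show "\<exists>M. \<forall>m\<ge>M. \<forall>n>m. dist (x m) (x n) < e" by blast
  qed
  then obtain l where l: "x \<longlonglongrightarrow> l" using Cauchy_convergent convergent_def by blast
  have lS: "l \<in> S"
    using S xS l closed_sequentially[of S x l] by (simp add: hilbert_subspace_def)
  have lim: "norm (l - x n) \<le> 1 / 3 ^ n / 2" for n
  proof (rule tendsto_upperbound)
    show "(\<lambda>k. norm (x k - x n)) \<longlonglongrightarrow> norm (l - x n)" by (intro tendsto_intros l)
    show "\<forall>\<^sub>F k in sequentially. norm (x k - x n) \<le> 1 / 3 ^ n / 2"
      using dist_le' by (auto intro!: eventually_sequentiallyI)
  qed simp
  obtain c c' where c: "\<And>y. y \<in> X \<Longrightarrow> y \<bullet> l \<le> c" "\<And>y. y \<in> X \<Longrightarrow> y \<bullet> (- l) \<le> c'"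
    using pw[OF lS] pw[OF subspace_neg[OF subS lS]] by blast
  obtain N where N: "2 * max c c' < real N" using reals_Archimedean2 by blast
  define n where "n = Suc N"
  define P where "P = norm (v n) / 3 ^ n"
  have "\<bar>v n \<bullet> l\<bar> \<le> max c c'" using c[OF v(1)[of n]] by auto
  moreover have "\<bar>v n \<bullet> (l - x n)\<bar> \<le> P / 2"
  proof -
    have "\<bar>v n \<bullet> (l - x n)\<bar> \<le> norm (v n) * (1 / 3 ^ n / 2)"
      by (rule order_trans[OF Cauchy_Schwarz_ineq2]) (intro mult_left_mono lim norm_ge_zero)
    then show ?thesis by (simp add: P_def)
  qed
  moreover have "P \<le> \<bar>v n \<bullet> x n\<bar>" using large unfolding n_def P_def .
  moreover have "v n \<bullet> l = v n \<bullet> x n + v n \<bullet> (l - x n)" by (simp add: inner_diff_right)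
  ultimately have "P / 2 \<le> max c c'" by linarith
  moreover have "real n < P" unfolding P_def using v(2)[of n] by (simp add: pos_less_divide_eq)
  ultimately show False using N by (simp add: n_def)
qed

lemma closed_convex_fun_const:
  assumes "closed D" "convex D" "D \<noteq> {}"
  shows "closed_convex_fun D (\<lambda>x. c)"
proof -
  have "epigraph D (\<lambda>x. c) = D \<times> {c..}" by (auto simp: epigraph_def)
  moreover have "convex_on D (\<lambda>x. c)"
    using assms(2) by (intro convex_onI) (auto simp: algebra_simps)
  ultimately show ?thesis
    using assms by (simp add: closed_convex_fun_def closed_Times)
qed

text \<open>
  This plays the part of weak sequential compactness. The points of minimal norm in the closed
  convex hulls of the tails have nondecreasing, bounded norms, and the variational
  characterization of the projection then makes them a Cauchy sequence. Its limit belongs to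
  every tail hull, hence satisfies every closed convex condition that the sequence eventually
  satisfies.
\<close>

lemma bounded_sequence_common_point:
  fixes z :: "nat \<Rightarrow> 'a::{real_inner,banach}"
  assumes bd: "bounded (range z)"
  obtains l where
    "\<And>A. closed A \<Longrightarrow> convex A \<Longrightarrow> (\<forall>\<^sub>F n in sequentially. z n \<in> A) \<Longrightarrow> l \<in> A"
proof -
  define D where "D n = closure (convex hull (z ` {n..}))" for n
  have D: "closed (D n)" "convex (D n)" "D n \<noteq> {}" for n
    by (auto simp: D_def)
  have anti: "D k \<subseteq> D n" if "n \<le> k" for n k
    unfolding D_def using that by (intro closure_mono hull_mono image_mono) auto
  obtain b where b: "\<And>n. norm (z n) \<le> b"
    using bd by (auto simp: bounded_iff)
  have Db: "D n \<subseteq> cball 0 b" for n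
    unfolding D_def using b by (intro closure_minimal hull_minimal) auto
  have "\<exists>p. p \<in> D n \<and> (\<forall>y\<in>D n. (y - p) \<bullet> (0 - p) + 0 \<le> (0::real))" for n
    using proximal_point_exists[OF closed_convex_fun_const[OF D(1,2,3)], of n 0 0] by metis
  then obtain p where p: "\<And>n. p n \<in> D n" "\<And>n y. y \<in> D n \<Longrightarrow> (y - p n) \<bullet> p n \<ge> 0"
    by (metis add.right_neutral diff_0 inner_minus_right neg_le_0_iff_le)
  have pyth: "(norm (p k - p n))\<^sup>2 \<le> (norm (p k))\<^sup>2 - (norm (p n))\<^sup>2" if "n \<le> k" for n k
  proof -
    have "(p k - p n) \<bullet> p n \<ge> 0" using p anti that by blast
    then show ?thesis
      by (simp add: power2_norm_eq_inner inner_diff_left inner_diff_right inner_commute)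
  qed
  have "incseq (\<lambda>n. (norm (p n))\<^sup>2)"
  proof (unfold incseq_def, intro allI impI)
    fix m n :: nat assume "m \<le> n"
    with pyth[OF this] show "(norm (p m))\<^sup>2 \<le> (norm (p n))\<^sup>2"
      using zero_le_power2[of "norm (p n - p m)"] by linarith
  qed
  moreover have "(norm (p n))\<^sup>2 \<le> b\<^sup>2" for n
  proof -
    have "norm (p n) \<le> b" using p(1) Db by fastforce
    then show ?thesis by (intro power_mono) auto
  qed
  ultimately obtain s where "(\<lambda>n. (norm (p n))\<^sup>2) \<longlonglongrightarrow> s"
    using incseq_convergent by metis
  then have Cs: "Cauchy (\<lambda>n. (norm (p n))\<^sup>2)" by (rule LIMSEQ_imp_Cauchy)
  have "Cauchy p"
  proof (rule CauchyI')
    fix e :: real assume "e > 0"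
    then obtain N where N: "\<And>m n. m \<ge> N \<Longrightarrow> n \<ge> N \<Longrightarrow> dist ((norm (p m))\<^sup>2) ((norm (p n))\<^sup>2) < e\<^sup>2"
      using metric_CauchyD[OF Cs, of "e\<^sup>2"] by (meson zero_less_power)
    have "dist (p m) (p n) < e" if "m \<ge> N" "n > m" for m n
    proof -
      have "(norm (p n - p m))\<^sup>2 \<le> (norm (p n))\<^sup>2 - (norm (p m))\<^sup>2"
        using pyth that by simp
      also have "\<dots> < e\<^sup>2" using N[of n m] that by (simp add: dist_real_def)
      finally show ?thesis
        using \<open>e > 0\<close> by (simp add: dist_norm norm_minus_commute power2_less_imp_less)
    qed
    then show "\<exists>M. \<forall>m\<ge>M. \<forall>n>m. dist (p m) (p n) < e" by blast
  qed
  then obtain l where l: "p \<longlonglongrightarrow> l" using Cauchy_convergent convergent_def by blast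
  have lD: "l \<in> D n" for n
  proof (rule closed_sequentially[OF D(1)])
    show "p (k + n) \<in> D n" for k using p(1) anti[of n "k + n"] by auto
    show "(\<lambda>k. p (k + n)) \<longlonglongrightarrow> l" using l by (rule LIMSEQ_ignore_initial_segment)
  qed
  show ?thesis
  proof (rule that)
    fix A :: "'a set"
    assume A: "closed A" "convex A" and "\<forall>\<^sub>F n in sequentially. z n \<in> A"
    then obtain n where "\<And>k. k \<ge> n \<Longrightarrow> z k \<in> A" by (auto simp: eventually_sequentially)
    then have "D n \<subseteq> A"
      unfolding D_def using A by (intro closure_minimal hull_minimal) auto
    then show "l \<in> A" using lD by blast
  qed
qed

section \<open>Riesz representation and adjoints\<close>

text \<open>
  The proximal point of \<open>- l\<close> at the origin, i.e. the minimizer of \<open>(norm x)\<^sup>2 / 2 - l x\<close>,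
  represents \<open>l\<close>. Linearity is only required on the subspace because adjoints and partial
  gradients are only linear there.
\<close>

lemma riesz_representation:
  fixes l :: "'a::{real_inner,banach} \<Rightarrow> real"
  assumes V: "hilbert_subspace V"
    and add: "\<And>x y. x \<in> V \<Longrightarrow> y \<in> V \<Longrightarrow> l (x + y) = l x + l y"
    and scale: "\<And>c x. x \<in> V \<Longrightarrow> l (c *\<^sub>R x) = c * l x"
    and bound: "\<And>x. x \<in> V \<Longrightarrow> \<bar>l x\<bar> \<le> B * norm x"
  shows "\<exists>!u. u \<in> V \<and> (\<forall>x\<in>V. l x = x \<bullet> u)"
proof -
  have sub: "subspace V" and cl: "closed V" using V by (auto simp: hilbert_subspace_def)
  have neg: "l (- x) = - l x" if "x \<in> V" for x using scale[OF that, of "- 1"] by simp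
  have diff: "l (x - y) = l x - l y" if "x \<in> V" "y \<in> V" for x y
    using add[of x "- y"] neg[of y] that subspace_neg[OF sub] by simp
  have "continuous_on V l"
  proof (rule lipschitz_on_continuous_on)
    show "lipschitz_on \<bar>B\<bar> V l"
    proof (rule lipschitz_onI)
      fix x y assume xy: "x \<in> V" "y \<in> V"
      have "\<bar>l (x - y)\<bar> \<le> B * norm (x - y)" using xy sub by (intro bound subspace_diff)
      also have "\<dots> \<le> \<bar>B\<bar> * norm (x - y)" by (intro mult_right_mono) auto
      finally show "dist (l x) (l y) \<le> \<bar>B\<bar> * dist x y"
        using diff[OF xy] by (simp add: dist_norm)
    qed simp
  qed
  have "closed (epigraph V (\<lambda>x. - l x))"
  proof (unfold closed_sequential_limits, intro allI impI, elim conjE)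
    fix z :: "nat \<Rightarrow> 'a \<times> real" and w
    assume z: "\<forall>n. z n \<in> epigraph V (\<lambda>x. - l x)" and lim: "z \<longlonglongrightarrow> w"
    have zV: "fst (z n) \<in> V" "- l (fst (z n)) \<le> snd (z n)" for n
      using z by (auto simp: epigraph_def)
    have lim1: "(\<lambda>n. fst (z n)) \<longlonglongrightarrow> fst w" and lim2: "(\<lambda>n. snd (z n)) \<longlonglongrightarrow> snd w"
      using lim by (auto intro: tendsto_fst tendsto_snd)
    have wV: "fst w \<in> V" by (rule closed_sequentially[OF cl zV(1) lim1])
    have "(\<lambda>n. l (fst (z n))) \<longlonglongrightarrow> l (fst w)"
      using continuous_on_tendsto_compose[OF \<open>continuous_on V l\<close> lim1 wV] zV(1) by simp
    then have "- l (fst w) \<le> snd w"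
      using lim2 zV(2) by (intro LIMSEQ_le[OF tendsto_minus]) auto
    with wV show "w \<in> epigraph V (\<lambda>x. - l x)" by (simp add: epigraph_def)
  qed
  moreover have "convex_on V (\<lambda>x. - l x)"
    using sub
    by (intro convex_onI) (auto simp: add scale subspace_scale subspace_imp_convex)
  moreover have "V \<noteq> {}" using subspace_0[OF sub] by auto
  ultimately have "closed_convex_fun V (\<lambda>x. - l x)" by (simp add: closed_convex_fun_def)
  then obtain p where p: "p \<in> V" "\<And>y. y \<in> V \<Longrightarrow> (y - p) \<bullet> (0 - p) + - l p \<le> - l y"
    using proximal_point_exists[of V "\<lambda>x. - l x" 0] by metis
  have le: "l y \<le> y \<bullet> p" if y: "y \<in> V" for y
    using p(2)[of "y + p"] add[OF y p(1)] subspace_add[OF sub y p(1)] by simp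
  have eq: "l y = y \<bullet> p" if y: "y \<in> V" for y
    using le[OF y] le[of "- y"] neg[OF y] subspace_neg[OF sub y] by simp
  show ?thesis
  proof (rule ex1I[of _ p])
    fix u assume u: "u \<in> V \<and> (\<forall>x\<in>V. l x = x \<bullet> u)"
    then have "u - p \<in> V" using p(1) sub by (simp add: subspace_diff)
    then have "(u - p) \<bullet> u = (u - p) \<bullet> p" using u eq by metis
    then have "(u - p) \<bullet> (u - p) = 0" by (simp add: inner_diff_right)
    then show "u = p" by simp
  qed (use p eq in auto)
qed

lemma bounded_linear_betweenD:
  assumes L: "bounded_linear_between V W L" and sub: "subspace V"
  shows "\<And>x. x \<in> V \<Longrightarrow> L x \<in> W"
    and "\<And>x y. x \<in> V \<Longrightarrow> y \<in> V \<Longrightarrow> L (x + y) = L x + L y"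
    and "\<And>x y. x \<in> V \<Longrightarrow> y \<in> V \<Longrightarrow> L (x - y) = L x - L y"
    and "\<And>c x. x \<in> V \<Longrightarrow> L (c *\<^sub>R x) = c *\<^sub>R L x"
proof -
  show add: "\<And>x y. x \<in> V \<Longrightarrow> y \<in> V \<Longrightarrow> L (x + y) = L x + L y"
    and sc: "\<And>c x. x \<in> V \<Longrightarrow> L (c *\<^sub>R x) = c *\<^sub>R L x"
    and "\<And>x. x \<in> V \<Longrightarrow> L x \<in> W"
    using L by (auto simp: bounded_linear_between_def)
  fix x y assume "x \<in> V" "y \<in> V"
  then show "L (x - y) = L x - L y"
    using add[of x "- y"] sc[of y "- 1"] subspace_neg[OF sub] by simp
qed

lemma bounded_linear_between_bound:
  assumes "bounded_linear_between V W L"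
  obtains B where "B \<ge> 0" "\<And>x. x \<in> V \<Longrightarrow> norm (L x) \<le> B * norm x"
proof -
  obtain B where B: "\<forall>x\<in>V. norm (L x) \<le> B * norm x"
    using assms unfolding bounded_linear_between_def by blast
  show ?thesis
  proof (rule that[of "\<bar>B\<bar>"])
    fix x assume "x \<in> V"
    then have "norm (L x) \<le> B * norm x" using B by blast
    also have "\<dots> \<le> \<bar>B\<bar> * norm x" by (intro mult_right_mono) auto
    finally show "norm (L x) \<le> \<bar>B\<bar> * norm x" .
  qed simp
qed

lemma adjoint_between:
  assumes V: "hilbert_subspace V" and L: "bounded_linear_between V W L"
  shows "adjoint_between V L v \<in> V"
    and "\<And>x. x \<in> V \<Longrightarrow> L x \<bullet> v = x \<bullet> adjoint_between V L v"
proof -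
  have sub: "subspace V" using V by (simp add: hilbert_subspace_def)
  obtain B where B: "B \<ge> 0" "\<And>x. x \<in> V \<Longrightarrow> norm (L x) \<le> B * norm x"
    using bounded_linear_between_bound[OF L] by blast
  have "\<bar>L x \<bullet> v\<bar> \<le> (B * norm v) * norm x" if "x \<in> V" for x
  proof -
    have "\<bar>L x \<bullet> v\<bar> \<le> norm (L x) * norm v" by (rule Cauchy_Schwarz_ineq2)
    also have "\<dots> \<le> (B * norm x) * norm v" using B(2)[OF that] by (intro mult_right_mono) auto
    finally show ?thesis by (simp add: mult.commute mult.left_commute)
  qed
  then have "\<exists>!u. u \<in> V \<and> (\<forall>x\<in>V. L x \<bullet> v = x \<bullet> u)"
    by (intro riesz_representation[OF V])
      (auto simp: bounded_linear_betweenD[OF L sub] inner_add_left)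
  from theI'[OF this] show "adjoint_between V L v \<in> V"
    "\<And>x. x \<in> V \<Longrightarrow> L x \<bullet> v = x \<bullet> adjoint_between V L v"
    unfolding adjoint_between_def by auto
qed

section \<open>Multipliers for monotone variational inequalities\<close>

lemma convex_sublevel_affine:
  assumes "convex_on D h"
  shows "convex {z :: 'a::real_inner \<times> 'b::real_inner. fst z \<in> D \<and> h (fst z) \<le> fst z \<bullet> p + snd z \<bullet> q + r}"
proof (rule convexI)
  fix x y :: "'a \<times> 'b" and s t :: real
  assume x: "x \<in> {z. fst z \<in> D \<and> h (fst z) \<le> fst z \<bullet> p + snd z \<bullet> q + r}"
    and y: "y \<in> {z. fst z \<in> D \<and> h (fst z) \<le> fst z \<bullet> p + snd z \<bullet> q + r}"
    and st: "0 \<le> s" "0 \<le> t" "s + t = 1"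
  have s: "s = 1 - t" using st by simp
  have "convex D" using assms by (simp add: convex_on_def)
  then have "fst (s *\<^sub>R x + t *\<^sub>R y) \<in> D"
    using x y st by (auto intro: convexD)
  moreover have "h (fst (s *\<^sub>R x + t *\<^sub>R y)) \<le> s * h (fst x) + t * h (fst y)"
    using convex_onD[OF assms, of t "fst x" "fst y"] x y st by (simp add: s)
  moreover have "s * h (fst x) + t * h (fst y)
      \<le> s * (fst x \<bullet> p + snd x \<bullet> q + r) + t * (fst y \<bullet> p + snd y \<bullet> q + r)"
    using x y st by (intro add_mono mult_left_mono) auto
  moreover have "s * (fst x \<bullet> p + snd x \<bullet> q + r) + t * (fst y \<bullet> p + snd y \<bullet> q + r)
      = fst (s *\<^sub>R x + t *\<^sub>R y) \<bullet> p + snd (s *\<^sub>R x + t *\<^sub>R y) \<bullet> q + r"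
    unfolding s by (simp add: inner_add_left algebra_simps)
  ultimately show "s *\<^sub>R x + t *\<^sub>R y \<in> {z. fst z \<in> D \<and> h (fst z) \<le> fst z \<bullet> p + snd z \<bullet> q + r}"
    by simp
qed

lemma closed_sublevel_affine:
  assumes "closed (epigraph D h)"
  shows "closed {z :: 'a::real_inner \<times> 'b::real_inner. fst z \<in> D \<and> h (fst z) \<le> fst z \<bullet> p + snd z \<bullet> q + r}"
proof -
  have eq: "{z :: 'a \<times> 'b. fst z \<in> D \<and> h (fst z) \<le> fst z \<bullet> p + snd z \<bullet> q + r}
      = (\<lambda>z. (fst z, fst z \<bullet> p + snd z \<bullet> q + r)) -` epigraph D h"
    by (auto simp: epigraph_def)
  have "continuous_on UNIV (\<lambda>z :: 'a \<times> 'b. (fst z, fst z \<bullet> p + snd z \<bullet> q + r))"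
    by (intro continuous_intros)
  then show ?thesis
    unfolding eq by (rule closed_vimage[OF assms])
qed

text \<open>
  The core of the existence proof: the variational inequality for \<open>h\<close> and \<open>B\<close> on the kernel of
  \<open>R\<close> has a solution, together with a multiplier \<open>v\<close> for the constraint \<open>R u = 0\<close>.
  
  The constraint is penalized and the problem regularized: for \<open>\<epsilon> > 0\<close> the operator
  \<open>T\<^sub>\<epsilon> = B + R\<^sup>*R / \<epsilon> + \<epsilon> (\<cdot> - u0)\<close> is strongly monotone and Lipschitzian, which gives \<open>u\<^sub>\<epsilon>\<close> and the
  approximate multiplier \<open>v\<^sub>\<epsilon> = R u\<^sub>\<epsilon> / \<epsilon>\<close>. Testing with the feasible point \<open>u0\<close> and using the
  coercivity hypothesis bounds every pairing with \<open>u\<^sub>\<epsilon>\<close>; testing with an arbitrary point \<open>a\<close> bounds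
  the pairing of \<open>- v\<^sub>\<epsilon>\<close> with \<open>R a\<close>, hence with every element of the cone generated by \<open>R ` D\<close>.
  This cone is a closed subspace that contains \<open>v\<^sub>\<epsilon>\<close>, so uniform boundedness applies twice.
  
  By monotonicity of \<open>B\<close> the limit may be taken in the Minty form of the inequality, in which
  \<open>B\<close> is evaluated at the fixed point \<open>a\<close>. There every condition on \<open>(u\<^sub>\<epsilon>, v\<^sub>\<epsilon>)\<close> is convex and closed,
  so that a common point of the tail hulls inherits it. Evaluating on short segments from the
  limit recovers the form with \<open>B\<close> at the solution.
\<close>

lemma vi_lagrange_multiplier:
  fixes h :: "'a::{real_inner,banach} \<Rightarrow> real" and B :: "'a \<Rightarrow> 'a"
    and R :: "'a \<Rightarrow> 'b::{real_inner,banach}"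
  assumes U: "hilbert_subspace U" and h: "closed_convex_fun D h" and DU: "D \<subseteq> U"
    and BU: "\<And>x. x \<in> U \<Longrightarrow> B x \<in> U" and lip: "lipschitz_on M U B"
    and mono: "\<And>x y. x \<in> U \<Longrightarrow> y \<in> U \<Longrightarrow> 0 \<le> (x - y) \<bullet> (B x - B y)"
    and R: "bounded_linear_between U W R"
    and u0: "u0 \<in> D" "R u0 = 0"
    and cone: "hilbert_subspace (\<Union>r\<in>{0<..}. (\<lambda>x. r *\<^sub>R R x) ` D)"
    and coercive: "\<And>w. w \<in> U \<Longrightarrow>
      \<exists>c. \<forall>x\<in>D. x \<bullet> w - c \<le> h x + (x - u0) \<bullet> B x + (norm (R x))\<^sup>2"
  shows "\<exists>u\<in>D. R u = 0 \<and> (\<exists>v\<in>(\<Union>r\<in>{0<..}. (\<lambda>x. r *\<^sub>R R x) ` D).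
    \<forall>a\<in>D. h u + (u - a) \<bullet> B u - R a \<bullet> v \<le> h a)"
proof -
  define S where "S = (\<Union>r\<in>{0<..}. (\<lambda>x. r *\<^sub>R R x) ` D)"
  note S = cone[folded S_def]
  have RS: "r *\<^sub>R R x \<in> S" if "r > 0" "x \<in> D" for r x
    using that by (auto simp: S_def)
  have sub: "subspace U" using U by (simp add: hilbert_subspace_def)
  have cv: "convex_on D h" and cl: "closed (epigraph D h)"
    using h by (auto simp: closed_convex_fun_def)
  note Rlin = bounded_linear_betweenD[OF R sub]
  obtain K where K: "K \<ge> 0" "\<And>x. x \<in> U \<Longrightarrow> norm (R x) \<le> K * norm x"
    using bounded_linear_between_bound[OF R] by blast
  define Rs where "Rs = adjoint_between U R"
  note Rs = adjoint_between[OF U R, folded Rs_def]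
  have M: "0 \<le> M" "\<And>x y. x \<in> U \<Longrightarrow> y \<in> U \<Longrightarrow> norm (B x - B y) \<le> M * norm (x - y)"
    using lip by (auto simp: lipschitz_on_def dist_norm)
  have Rs_lip: "norm (Rs w - Rs w') \<le> K * norm (w - w')" for w w'
  proof -
    define d where "d = Rs w - Rs w'"
    have dU: "d \<in> U" using Rs(1) sub by (simp add: d_def subspace_diff)
    have "(norm d)\<^sup>2 = d \<bullet> Rs w - d \<bullet> Rs w'"
      by (simp add: power2_norm_eq_inner d_def inner_diff_right)
    also have "\<dots> = R d \<bullet> (w - w')" using Rs(2)[OF dU] by (simp add: inner_diff_right)
    also have "\<dots> \<le> norm (R d) * norm (w - w')" by (rule norm_cauchy_schwarz)
    also have "\<dots> \<le> K * norm d * norm (w - w')"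
      using K(2)[OF dU] by (intro mult_right_mono) auto
    finally show ?thesis
      using K(1) by (cases "norm d = 0") (auto simp: d_def power2_eq_square)
  qed
  define \<epsilon> where "\<epsilon> n = 1 / real (Suc n)" for n
  have \<epsilon>: "\<epsilon> n > 0" "1 \<le> 1 / \<epsilon> n" "\<epsilon> n \<le> 1" for n by (simp_all add: \<epsilon>_def)
  have \<epsilon>0: "\<epsilon> \<longlonglongrightarrow> 0" unfolding \<epsilon>_def using LIMSEQ_Suc[OF lim_1_over_n] by simp
  define T where "T n x = B x + (1 / \<epsilon> n) *\<^sub>R Rs (R x) + \<epsilon> n *\<^sub>R (x - u0)" for n x
  have u0U: "u0 \<in> U" using u0 DU by blast
  have "\<exists>x. x \<in> D \<and> (\<forall>y\<in>D. h x + (x - y) \<bullet> T n x \<le> h y)" for n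
  proof -
    have "lipschitz_on (M + K * K / \<epsilon> n + \<epsilon> n) U (T n)"
    proof (rule lipschitz_onI)
      fix x y assume xy: "x \<in> U" "y \<in> U"
      have "norm (Rs (R x) - Rs (R y)) \<le> K * (K * norm (x - y))"
        using K(2)[of "x - y"] xy sub
        by (intro order_trans[OF Rs_lip] mult_left_mono K(1)) (simp add: Rlin subspace_diff)
      then have "norm ((1 / \<epsilon> n) *\<^sub>R (Rs (R x) - Rs (R y))) \<le> 1 / \<epsilon> n * (K * (K * norm (x - y)))"
        using \<epsilon>(1)[of n] by (simp add: divide_right_mono)
      then have "norm ((B x - B y) + (1 / \<epsilon> n) *\<^sub>R (Rs (R x) - Rs (R y)) + \<epsilon> n *\<^sub>R (x - y))
          \<le> M * norm (x - y) + 1 / \<epsilon> n * (K * (K * norm (x - y))) + \<epsilon> n * norm (x - y)"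
        using M(2)[OF xy] \<epsilon>(1)[of n] by (intro norm_triangle_mono) auto
      also have "(B x - B y) + (1 / \<epsilon> n) *\<^sub>R (Rs (R x) - Rs (R y)) + \<epsilon> n *\<^sub>R (x - y) = T n x - T n y"
        by (simp add: T_def algebra_simps)
      finally show "dist (T n x) (T n y) \<le> (M + K * K / \<epsilon> n + \<epsilon> n) * dist x y"
        by (simp add: dist_norm algebra_simps)
    qed (use M K \<epsilon>(1)[of n] in auto)
    moreover have "T n x \<in> U" if "x \<in> U" for x
      unfolding T_def using that sub BU Rs(1) u0U
      by (intro subspace_add subspace_scale subspace_diff) auto
    moreover have "\<epsilon> n * (norm (x - y))\<^sup>2 \<le> (x - y) \<bullet> (T n x - T n y)"
      if xy: "x \<in> U" "y \<in> U" for x y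
    proof -
      have dU: "x - y \<in> U" using xy sub by (simp add: subspace_diff)
      have "(x - y) \<bullet> (Rs (R x) - Rs (R y)) = (norm (R (x - y)))\<^sup>2"
        using Rs(2)[OF dU] xy by (simp add: inner_diff_right power2_norm_eq_inner Rlin)
      moreover have "T n x - T n y
          = (B x - B y) + (1 / \<epsilon> n) *\<^sub>R (Rs (R x) - Rs (R y)) + \<epsilon> n *\<^sub>R (x - y)"
        by (simp add: T_def algebra_simps)
      ultimately have "(x - y) \<bullet> (T n x - T n y) = (x - y) \<bullet> (B x - B y)
          + (norm (R (x - y)))\<^sup>2 / \<epsilon> n + \<epsilon> n * (norm (x - y))\<^sup>2"
        by (simp only: inner_add_right inner_scaleR_right power2_norm_eq_inner) simp
      then show ?thesis using mono[OF xy] \<epsilon>(1)[of n] by simp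
    qed
    ultimately show ?thesis
      using strongly_monotone_vi_solution[OF U h DU _ _ \<epsilon>(1), of "T n" _ n] by metis
  qed
  then obtain u where u: "\<And>n. u n \<in> D" "\<And>n y. y \<in> D \<Longrightarrow> h (u n) + (u n - y) \<bullet> T n (u n) \<le> h y"
    by metis
  have uU: "u n \<in> U" for n using u(1) DU by blast
  define v where "v n = (1 / \<epsilon> n) *\<^sub>R R (u n)" for n
  have vS: "v n \<in> S" for n unfolding v_def using \<epsilon>(1)[of n] u(1) by (intro RS) auto
  (* The penalty term, tested with u n - a, splits into a nonnegative part and a pairing of the
     approximate multiplier with R a. *)
  have vi: "h (u n) + (u n - a) \<bullet> B (u n) + \<epsilon> n * (norm (v n))\<^sup>2 - R a \<bullet> v n
      + \<epsilon> n * ((u n - a) \<bullet> (u n - u0)) \<le> h a" if a: "a \<in> D" for a n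
  proof -
    have aU: "a \<in> U" using a DU by blast
    have "(u n - a) \<bullet> Rs (R (u n)) = R (u n) \<bullet> R (u n) - R a \<bullet> R (u n)"
      using Rs(2)[of "u n - a" "R (u n)"] uU aU sub by (simp add: subspace_diff Rlin inner_diff_left)
    then have "(u n - a) \<bullet> ((1 / \<epsilon> n) *\<^sub>R Rs (R (u n))) = \<epsilon> n * (norm (v n))\<^sup>2 - R a \<bullet> v n"
      using \<epsilon>(1)[of n] unfolding v_def power2_norm_eq_inner by (simp add: diff_divide_distrib)
    then show ?thesis
      using u(2)[OF a, of n] by (simp add: T_def inner_add_right)
  qed
  have "bounded (range u)"
  proof (rule bounded_if_pointwise_bounded_above[OF U])
    fix w assume "w \<in> U"
    then obtain c where c: "\<And>x. x \<in> D \<Longrightarrow> x \<bullet> w - c \<le> h x + (x - u0) \<bullet> B x + (norm (R x))\<^sup>2"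
      using coercive by blast
    have "u n \<bullet> w \<le> c + h u0" for n
    proof -
      have "(norm (R (u n)))\<^sup>2 * 1 \<le> (norm (R (u n)))\<^sup>2 * (1 / \<epsilon> n)"
        using \<epsilon>(2) by (intro mult_left_mono) auto
      also have "\<dots> = \<epsilon> n * (norm (v n))\<^sup>2"
        using \<epsilon>(1)[of n] by (simp add: v_def power2_eq_square)
      finally have "(norm (R (u n)))\<^sup>2 \<le> \<epsilon> n * (norm (v n))\<^sup>2" by simp
      moreover have "0 \<le> \<epsilon> n * ((u n - u0) \<bullet> (u n - u0))"
        using \<epsilon>(1)[of n] by (intro mult_nonneg_nonneg) auto
      ultimately show ?thesis using vi[OF u0(1), of n] c[OF u(1), of n] u0(2) by simp
    qed
    then show "\<exists>c. \<forall>x\<in>range u. x \<bullet> w \<le> c" by blast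
  qed (use uU in auto)
  then obtain C where C: "\<And>n. norm (u n) \<le> C" by (auto simp: bounded_iff)
  have C0: "C \<ge> 0" using order_trans[OF norm_ge_zero C] .
  have dC: "norm (u n - a) \<le> C + norm a" for n a
    using norm_triangle_ineq4[of "u n" a] C[of n] by simp
  obtain c where c: "c \<ge> 0" "\<And>x. x \<in> D \<Longrightarrow> - c * (1 + norm x) \<le> h x"
    using closed_convex_fun_lower_bound[OF h] by blast
  have hC: "- c * (1 + C) \<le> h (u n)" for n
  proof -
    have "c * norm (u n) \<le> c * C" using c(1) C by (intro mult_left_mono)
    then show ?thesis using c(2)[OF u(1), of n] by (simp add: distrib_left)
  qed
  define C' where "C' = norm (B u0) + M * (C + norm u0)"
  have BC: "norm (B (u n)) \<le> C'" for n
  proof -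
    have "norm (B (u n)) \<le> norm (B u0) + norm (B (u n) - B u0)" by (rule norm_triangle_sub)
    also have "norm (B (u n) - B u0) \<le> M * (C + norm u0)"
      by (intro order_trans[OF M(2)[OF uU u0U]] mult_left_mono dC M(1))
    finally show ?thesis by (simp add: C'_def)
  qed
  have quadC: "\<bar>(u n - a) \<bullet> (u n - u0)\<bar> \<le> (C + norm a) * (C + norm u0)" for n a
    using C0 by (intro order_trans[OF Cauchy_Schwarz_ineq2] mult_mono dC) auto
  have "bounded (uminus ` range v)"
  proof (rule bounded_if_pointwise_bounded_above[OF S])
    have subS: "subspace S" using S by (simp add: hilbert_subspace_def)
    show "uminus ` range v \<subseteq> S" using vS subspace_neg[OF subS] by auto
    fix s assume "s \<in> S"
    then obtain r a where ra: "r > 0" "a \<in> D" "s = r *\<^sub>R R a" by (auto simp: S_def)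
    define c' where "c' = h a + c * (1 + C) + (C + norm a) * C' + (C + norm a) * (C + norm u0)"
    have "- v n \<bullet> s \<le> r * c'" for n
    proof -
      have "\<bar>(u n - a) \<bullet> B (u n)\<bar> \<le> (C + norm a) * C'"
        using C0 by (intro order_trans[OF Cauchy_Schwarz_ineq2] mult_mono dC BC) auto
      moreover have "\<bar>\<epsilon> n * ((u n - a) \<bullet> (u n - u0))\<bar> \<le> 1 * ((C + norm a) * (C + norm u0))"
        unfolding abs_mult using \<epsilon>[of n] by (intro mult_mono quadC) auto
      moreover have "0 \<le> \<epsilon> n * (norm (v n))\<^sup>2" using \<epsilon>(1)[of n] by simp
      ultimately have "- (R a \<bullet> v n) \<le> c'"
        using vi[OF ra(2), of n] hC[of n] unfolding c'_def by linarith
      then have "r * - (R a \<bullet> v n) \<le> r * c'" using ra(1) by (intro mult_left_mono) auto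
      then show ?thesis by (simp add: ra(3) inner_commute)
    qed
    then show "\<exists>c. \<forall>x\<in>uminus ` range v. x \<bullet> s \<le> c" by blast
  qed
  then obtain Cv where Cv: "\<And>n. norm (v n) \<le> Cv" by (auto simp: bounded_iff)
  have "bounded (range (\<lambda>n. (u n, v n)))"
    by (rule bounded_subset[of "cball 0 C \<times> cball 0 Cv"])
      (use C Cv in \<open>auto intro: bounded_Times\<close>)
  then obtain l where l: "\<And>A. closed A \<Longrightarrow> convex A \<Longrightarrow>
      (\<forall>\<^sub>F n in sequentially. (u n, v n) \<in> A) \<Longrightarrow> l \<in> A"
    using bounded_sequence_common_point[of "\<lambda>n. (u n, v n)"] by metis
  define x y where "x = fst l" and "y = snd l"
  have yS: "y \<in> S"
  proof -
    have "l \<in> UNIV \<times> S"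
      using S vS
      by (intro l closed_Times convex_Times subspace_imp_convex) (auto simp: hilbert_subspace_def)
    then show ?thesis by (auto simp: y_def)
  qed
  (* The tolerance delta absorbs the regularization, which tends to 0 for each fixed a. *)
  have minty: "x \<in> D \<and> h x \<le> h a - (x - a) \<bullet> B a + R a \<bullet> y" if a: "a \<in> D" for a
  proof -
    have aU: "a \<in> U" using a DU by blast
    have ev: "x \<in> D \<and> h x \<le> x \<bullet> (- B a) + y \<bullet> R a + (h a + a \<bullet> B a + \<delta>)" if \<delta>: "\<delta> > 0" for \<delta>
    proof -
      define A where "A = {z. fst z \<in> D \<and> h (fst z) \<le> fst z \<bullet> (- B a) + snd z \<bullet> R a + (h a + a \<bullet> B a + \<delta>)}"
      have "(\<lambda>n. \<epsilon> n * ((C + norm a) * (C + norm u0))) \<longlonglongrightarrow> 0 * ((C + norm a) * (C + norm u0))"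
        by (intro tendsto_intros \<epsilon>0)
      then have "\<forall>\<^sub>F n in sequentially. \<epsilon> n * ((C + norm a) * (C + norm u0)) < \<delta>"
        using \<delta> by (intro order_tendstoD(2)) auto
      then have "\<forall>\<^sub>F n in sequentially. (u n, v n) \<in> A"
      proof eventually_elim
        case (elim n)
        have "\<epsilon> n * - ((u n - a) \<bullet> (u n - u0)) \<le> \<epsilon> n * ((C + norm a) * (C + norm u0))"
          using quadC[of n a] \<epsilon>(1)[of n] by (intro mult_left_mono) auto
        moreover have "0 \<le> \<epsilon> n * (norm (v n))\<^sup>2" using \<epsilon>(1)[of n] by simp
        moreover have "(u n - a) \<bullet> B a \<le> (u n - a) \<bullet> B (u n)"
          using mono[OF uU aU] by (simp add: inner_diff_right)
        ultimately have "h (u n) \<le> h a - (u n - a) \<bullet> B a + R a \<bullet> v n + \<delta>"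
          using vi[OF a, of n] elim unfolding mult_minus_right by linarith
        then show ?case
          using u(1) by (simp add: A_def inner_diff_left inner_commute[of "R a"])
      qed
      then have "l \<in> A"
        unfolding A_def
        by (intro l closed_sublevel_affine[OF cl] convex_sublevel_affine[OF cv])
      then show ?thesis by (simp add: A_def x_def y_def)
    qed
    have "h x \<le> x \<bullet> (- B a) + y \<bullet> R a + (h a + a \<bullet> B a)"
    proof (rule field_le_epsilon)
      fix \<delta> :: real assume "0 < \<delta>"
      from ev[OF this] show "h x \<le> x \<bullet> (- B a) + y \<bullet> R a + (h a + a \<bullet> B a) + \<delta>"
        by linarith
    qed
    moreover have "x \<in> D" using ev[of 1] by simp
    moreover have "y \<bullet> R a = R a \<bullet> y" by (rule inner_commute)
    ultimately show ?thesis by (simp add: inner_diff_left)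
  qed
  have xD: "x \<in> D" using minty u0 by blast
  have xU: "x \<in> U" using xD DU by blast
  have Rx: "R x = 0"
  proof -
    define w where "w = R x"
    (* R is linear on U only; passing to the adjoint turns the condition on R (u n) into a
       half-space condition in the whole space. *)
    have le: "x \<bullet> Rs w \<le> 0 + \<delta>" if \<delta>: "\<delta> > 0" for \<delta>
    proof -
      define A where "A = {z :: 'a \<times> 'b. Rs w \<bullet> fst z \<le> \<delta>}"
      have "A = {z. inner (Rs w, 0) z \<le> \<delta>}" by (auto simp: A_def inner_prod_def)
      then have A: "closed A" "convex A"
        using closed_halfspace_le convex_halfspace_le by auto
      have "(\<lambda>n. \<epsilon> n * (Cv * norm w)) \<longlonglongrightarrow> 0 * (Cv * norm w)"
        by (intro tendsto_intros \<epsilon>0)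
      then have "\<forall>\<^sub>F n in sequentially. \<epsilon> n * (Cv * norm w) < \<delta>"
        using \<delta> by (intro order_tendstoD(2)) auto
      then have "\<forall>\<^sub>F n in sequentially. (u n, v n) \<in> A"
      proof eventually_elim
        case (elim n)
        have "u n \<bullet> Rs w = \<epsilon> n * (v n \<bullet> w)"
          using Rs(2)[OF uU, of n w] \<epsilon>(1)[of n] by (simp add: v_def)
        also have "\<dots> \<le> \<epsilon> n * (Cv * norm w)"
          using \<epsilon>(1)[of n] Cv
          by (intro mult_left_mono order_trans[OF norm_cauchy_schwarz] mult_right_mono) auto
        finally show ?case using elim by (simp add: A_def inner_commute)
      qed
      then have "l \<in> A" by (intro l A)
      then show ?thesis by (simp add: A_def x_def inner_commute)
    qed
    have "R x \<bullet> w \<le> 0"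
      using field_le_epsilon[OF le] Rs(2)[OF xU] by simp
    then show ?thesis using inner_gt_zero_iff[of "R x"] by (auto simp: w_def not_less[symmetric])
  qed
  have "h x + (x - a) \<bullet> B x - R a \<bullet> y \<le> h a" if a: "a \<in> D" for a
  proof -
    have "0 \<le> (h a - h x - (x - a) \<bullet> B x + R a \<bullet> y) + t * (M * (norm (x - a))\<^sup>2)"
      if t: "0 < t" "t < 1" for t
    proof -
      define q where "q = (1 - t) *\<^sub>R x + t *\<^sub>R a"
      have aU: "a \<in> U" using a DU by blast
      have "convex D" using cv by (simp add: convex_on_def)
      then have qD: "q \<in> D" unfolding q_def using a xD t by (intro convexD) auto
      have qU: "q \<in> U" using qD DU by blast
      have hq: "h q \<le> (1 - t) * h x + t * h a"
        unfolding q_def using a xD t by (intro convex_onD[OF cv]) auto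
      have xq: "x - q = t *\<^sub>R (x - a)" by (simp add: q_def algebra_simps)
      have Rq: "R q = t *\<^sub>R R a"
        unfolding q_def using xU aU sub Rx by (simp add: Rlin subspace_scale)
      have "(x - a) \<bullet> (B x - B q) \<le> norm (x - a) * (M * norm (x - q))"
        by (intro order_trans[OF norm_cauchy_schwarz] mult_left_mono M(2) xU qU norm_ge_zero)
      also have "\<dots> = t * (M * (norm (x - a))\<^sup>2)"
        using t by (simp add: xq power2_eq_square)
      finally have Bq: "(x - a) \<bullet> B x - t * (M * (norm (x - a))\<^sup>2) \<le> (x - a) \<bullet> B q"
        by (simp add: inner_diff_right)
      have "h x \<le> (1 - t) * h x + t * h a - t * ((x - a) \<bullet> B q) + t * (R a \<bullet> y)"
        using minty[OF qD] hq by (simp add: xq Rq)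
      then have "0 \<le> t * (h a - h x - (x - a) \<bullet> B q + R a \<bullet> y)"
        by (simp add: algebra_simps)
      then have "0 \<le> h a - h x - (x - a) \<bullet> B q + R a \<bullet> y"
        using t by (simp add: zero_le_mult_iff)
      then show ?thesis using Bq by simp
    qed
    then have "0 \<le> h a - h x - (x - a) \<bullet> B x + R a \<bullet> y" by (rule nonneg_if_nonneg_perturbed)
    then show ?thesis by simp
  qed
  then show ?thesis using xD Rx yS unfolding S_def by blast
qed

text \<open>
  The multiplier theorem on the product space, with the splitting \<open>y = L x\<close> as the constraint
  \<open>L x - y = 0\<close>. The cone hypothesis there becomes the qualification condition on
  \<open>L ` D - E\<close>. Coercivity is only needed in \<open>x\<close>: an affine minorant of \<open>h\<close> bounds \<open>h y\<close> from
  below by an affine function of \<open>L x\<close> and of \<open>L x - y\<close>, and the latter is absorbed by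
  the square of the constraint residual. Varying \<open>x\<close> and \<open>y\<close> separately gives the subgradient
  conditions for both functions.
\<close>

lemma vi_composite_multiplier:
  fixes f :: "'a::{real_inner,banach} \<Rightarrow> real" and h :: "'b::{real_inner,banach} \<Rightarrow> real"
    and B :: "'a \<Rightarrow> 'a" and L :: "'a \<Rightarrow> 'b"
  assumes V: "hilbert_subspace V" and W: "hilbert_subspace W"
    and f: "closed_convex_fun D f" and DV: "D \<subseteq> V"
    and h: "closed_convex_fun E h" and EW: "E \<subseteq> W"
    and BV: "\<And>x. x \<in> V \<Longrightarrow> B x \<in> V" and lip: "lipschitz_on M V B"
    and mono: "\<And>x y. x \<in> V \<Longrightarrow> y \<in> V \<Longrightarrow> 0 \<le> (x - y) \<bullet> (B x - B y)"
    and L: "bounded_linear_between V W L"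
    and x0: "x0 \<in> D" "L x0 \<in> E"
    and cone: "hilbert_subspace (\<Union>r\<in>{0<..}. (\<lambda>z. r *\<^sub>R (L (fst z) - snd z)) ` (D \<times> E))"
    and coercive: "\<And>w. w \<in> V \<Longrightarrow> \<exists>c. \<forall>x\<in>D. x \<bullet> w - c \<le> f x + (x - x0) \<bullet> B x"
  shows "\<exists>x\<in>D. \<exists>v\<in>W. L x \<in> E \<and>
    (\<forall>a\<in>D. f x - (a - x) \<bullet> B x - L (a - x) \<bullet> v \<le> f a) \<and>
    (\<forall>b\<in>E. h (L x) + (b - L x) \<bullet> v \<le> h b)"
proof -
  define U where "U = V \<times> W"
  define F where "F z = f (fst z) + h (snd z)" for z
  define A where "A z = (B (fst z), 0 :: 'b)" for z :: "'a \<times> 'b"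
  define R where "R z = L (fst z) - snd z" for z
  have subV: "subspace V" and subW: "subspace W" using V W by (auto simp: hilbert_subspace_def)
  note Llin = bounded_linear_betweenD[OF L subV]
  obtain k where k: "k \<ge> 0" "\<And>x. x \<in> V \<Longrightarrow> norm (L x) \<le> k * norm x"
    using bounded_linear_between_bound[OF L] by blast
  have U: "hilbert_subspace U"
    using V W by (auto simp: U_def hilbert_subspace_def intro: subspace_Times closed_Times)
  have F: "closed_convex_fun (D \<times> E) F"
    unfolding F_def by (rule closed_convex_fun_prod[OF f h])
  have DU: "D \<times> E \<subseteq> U" using DV EW by (auto simp: U_def)
  have AU: "A z \<in> U" if "z \<in> U" for z
    using that BV subspace_0[OF subW] by (auto simp: A_def U_def)
  have Alip: "lipschitz_on M U A"
  proof (rule lipschitz_onI)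
    show M0: "0 \<le> M" using lip by (simp add: lipschitz_on_def)
    fix z z' assume "z \<in> U" "z' \<in> U"
    then have "dist (B (fst z)) (B (fst z')) \<le> M * dist (fst z) (fst z')"
      using lip by (auto simp: lipschitz_on_def U_def)
    also have "\<dots> \<le> M * dist z z'" using dist_fst_le M0 by (intro mult_left_mono)
    finally show "dist (A z) (A z') \<le> M * dist z z'"
      by (simp add: A_def dist_Pair_Pair)
  qed
  have Amono: "0 \<le> (z - z') \<bullet> (A z - A z')" if "z \<in> U" "z' \<in> U" for z z'
    using mono that by (auto simp: A_def U_def)
  have Rb: "bounded_linear_between U W R"
    unfolding bounded_linear_between_def
  proof (intro conjI)
    show "R \<in> U \<rightarrow> W" using Llin(1) subspace_diff[OF subW] by (auto simp: R_def U_def)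
    show "\<forall>z\<in>U. \<forall>z'\<in>U. R (z + z') = R z + R z'" by (auto simp: R_def U_def Llin)
    show "\<forall>z\<in>U. \<forall>c. R (c *\<^sub>R z) = c *\<^sub>R R z"
      by (auto simp: R_def U_def Llin scaleR_diff_right)
    have "norm (R z) \<le> (k + 1) * norm z" if zU: "z \<in> U" for z
    proof -
      obtain x y where z: "z = (x, y)" "x \<in> V" using zU by (auto simp: U_def)
      have "norm (R z) \<le> norm (L x) + norm y"
        unfolding R_def z by (simp add: norm_triangle_ineq4)
      also have "\<dots> \<le> k * norm z + norm z"
        unfolding z(1)
        by (intro add_mono order_trans[OF k(2)[OF z(2)]] mult_left_mono k(1) norm_fst_le norm_snd_le)
      finally show ?thesis by (simp add: distrib_right)
    qed
    then show "\<exists>B. \<forall>z\<in>U. norm (R z) \<le> B * norm z" by blast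
  qed
  define z0 where "z0 = (x0, L x0)"
  have z0: "z0 \<in> D \<times> E" "R z0 = 0" using x0 by (auto simp: z0_def R_def)
  obtain p where p: "p \<in> E" "\<And>y. y \<in> E \<Longrightarrow> (y - p) \<bullet> (0 - p) + h p \<le> h y"
    using proximal_point_exists[OF h, of 0] by metis
  have coer: "\<exists>c. \<forall>z\<in>D \<times> E. z \<bullet> w - c \<le> F z + (z - z0) \<bullet> A z + (norm (R z))\<^sup>2"
    if w: "w \<in> U" for w
  proof -
    (* The slope - p of the affine minorant of h, minus the prescribed slope in the second
       component; the adjoint transports it to the first component. *)
    define q where "q = - p - snd w"
    have "fst w - adjoint_between V L q \<in> V"
      using w adjoint_between(1)[OF V L] subV by (auto simp: U_def intro: subspace_diff)
    then obtain c where c: "\<And>x. x \<in> D \<Longrightarrow>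
        x \<bullet> (fst w - adjoint_between V L q) - c \<le> f x + (x - x0) \<bullet> B x"
      using coercive by blast
    have "z \<bullet> w - (c - p \<bullet> p - h p + (norm q)\<^sup>2 / 4) \<le> F z + (z - z0) \<bullet> A z + (norm (R z))\<^sup>2"
      if z: "z \<in> D \<times> E" for z
    proof -
      obtain x y where xy: "z = (x, y)" "x \<in> D" "y \<in> E" using z by auto
      have "L x \<bullet> q = x \<bullet> adjoint_between V L q"
        using adjoint_between(2)[OF V L] xy DV by blast
      moreover have "0 \<le> (norm (L x - y - (1/2) *\<^sub>R q))\<^sup>2" by simp
      then have "0 \<le> (norm (L x - y))\<^sup>2 - (L x - y) \<bullet> q + (norm q)\<^sup>2 / 4"
        unfolding power2_norm_eq_inner
        by (simp add: inner_diff_left inner_diff_right inner_commute algebra_simps)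
      moreover have "y \<bullet> q = - (y \<bullet> p) - y \<bullet> snd w" by (simp add: q_def inner_diff_right)
      ultimately show ?thesis
        using c[OF xy(2)] p(2)[OF xy(3)]
        by (simp add: F_def A_def R_def z0_def xy(1) inner_prod_def inner_diff_left inner_diff_right)
    qed
    then show ?thesis by blast
  qed
  have cone': "hilbert_subspace (\<Union>r\<in>{0<..}. (\<lambda>z. r *\<^sub>R R z) ` (D \<times> E))"
    using cone by (simp add: R_def)
  obtain z v where z: "z \<in> D \<times> E" "R z = 0"
    and v: "v \<in> (\<Union>r\<in>{0<..}. (\<lambda>z. r *\<^sub>R R z) ` (D \<times> E))"
    and vi: "\<And>a. a \<in> D \<times> E \<Longrightarrow> F z + (z - a) \<bullet> A z - R a \<bullet> v \<le> F a"
    using vi_lagrange_multiplier[OF U F DU AU Alip Amono Rb z0 cone' coer] by blast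
  have vW: "v \<in> W"
    using v DU bounded_linear_betweenD(1)[OF Rb] U subW
    by (auto simp: hilbert_subspace_def intro!: subspace_scale)
  obtain x where x: "z = (x, L x)" "x \<in> D" "L x \<in> E"
    using z by (auto simp: R_def)
  have xV: "x \<in> V" using x DV by blast
  have "f x - (a - x) \<bullet> B x - L (a - x) \<bullet> v \<le> f a" if "a \<in> D" for a
  proof -
    have "a \<in> V" using that DV by blast
    then show ?thesis
      using vi[of "(a, L x)"] that x xV
      by (simp add: F_def A_def R_def Llin inner_diff_left)
  qed
  moreover have "h (L x) + (b - L x) \<bullet> v \<le> h b" if "b \<in> E" for b
    using vi[of "(x, b)"] that x by (simp add: F_def A_def R_def inner_diff_left)
  ultimately show ?thesis using x vW by blast
qed

section \<open>Affine minorants of functions in the class \<open>\<Gamma>\<^sub>0\<close>\<close>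

lemma Gamma0_ereal_real:
  assumes "Gamma0 V \<phi>" "x \<in> eff_dom V \<phi>"
  shows "\<phi> x = ereal (real_of_ereal (\<phi> x))"
  using assms by (cases "\<phi> x") (auto simp: Gamma0_def eff_dom_def)

lemma Gamma0_closed_convex_fun:
  fixes \<phi> :: "'a::{real_inner,banach} \<Rightarrow> ereal"
  assumes V: "hilbert_subspace V" and \<phi>: "Gamma0 V \<phi>"
  shows "closed_convex_fun (eff_dom V \<phi>) (\<lambda>x. real_of_ereal (\<phi> x))"
proof -
  let ?D = "eff_dom V \<phi>" and ?h = "\<lambda>x. real_of_ereal (\<phi> x)"
  note real = Gamma0_ereal_real[OF \<phi>]
  have sub: "subspace V" and clV: "closed V" using V by (auto simp: hilbert_subspace_def)
  have cvx: "(1 - t) *\<^sub>R x + t *\<^sub>R y \<in> ?D \<and> ?h ((1 - t) *\<^sub>R x + t *\<^sub>R y) \<le> (1 - t) * ?h x + t * ?h y"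
    if t: "0 < t" "t < 1" and xy: "x \<in> ?D" "y \<in> ?D" for t x y
  proof -
    let ?q = "(1 - t) *\<^sub>R x + t *\<^sub>R y"
    have V': "x \<in> V" "y \<in> V" using xy by (auto simp: eff_dom_def)
    then have "\<forall>\<alpha>\<in>{0<..<1}. \<phi> (\<alpha> *\<^sub>R x + (1 - \<alpha>) *\<^sub>R y) \<le> ereal \<alpha> * \<phi> x + ereal (1 - \<alpha>) * \<phi> y"
      using \<phi> by (simp add: Gamma0_def)
    from bspec[OF this, of "1 - t"] have "\<phi> ?q \<le> ereal (1 - t) * \<phi> x + ereal t * \<phi> y"
      using t by simp
    also have "\<dots> = ereal ((1 - t) * ?h x + t * ?h y)"
      by (subst real[OF xy(1)], subst real[OF xy(2)]) simp
    finally have le: "\<phi> ?q \<le> ereal ((1 - t) * ?h x + t * ?h y)" .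
    moreover have "?q \<in> V" using V' sub by (intro subspace_add subspace_scale)
    ultimately have "?q \<in> ?D" by (auto simp: eff_dom_def intro: le_less_trans)
    then show ?thesis using le by (subst (asm) real) auto
  qed
  have "convex ?D"
  proof (rule convexI)
    fix x y and s t :: real
    assume "x \<in> ?D" "y \<in> ?D" "0 \<le> s" "0 \<le> t" "s + t = 1"
    then show "s *\<^sub>R x + t *\<^sub>R y \<in> ?D"
      using cvx[of t x y] by (cases "t = 0 \<or> t = 1") (auto simp: eq_diff_eq[symmetric])
  qed
  then have "convex_on ?D ?h" using cvx by (intro convex_onI) auto
  moreover have "closed (epigraph ?D ?h)"
  proof (unfold closed_sequential_limits, intro allI impI, elim conjE)
    fix z :: "nat \<Rightarrow> 'a \<times> real" and w
    assume z: "\<forall>n. z n \<in> epigraph ?D ?h" and lim: "z \<longlonglongrightarrow> w"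
    have zD: "fst (z n) \<in> ?D" "?h (fst (z n)) \<le> snd (z n)" for n
      using z by (auto simp: epigraph_def)
    have zV: "fst (z n) \<in> V" for n using zD(1) by (auto simp: eff_dom_def)
    have lim1: "(\<lambda>n. fst (z n)) \<longlonglongrightarrow> fst w" and lim2: "(\<lambda>n. snd (z n)) \<longlonglongrightarrow> snd w"
      using lim by (auto intro: tendsto_fst tendsto_snd)
    have wV: "fst w \<in> V" by (rule closed_sequentially[OF clV zV lim1])
    have "\<phi> (fst w) \<le> ereal (snd w)"
    proof (rule ccontr)
      assume "\<not> ?thesis"
      then have "ereal (snd w) < \<phi> (fst w)" by simp
      then obtain s where s: "ereal (snd w) < ereal s" "ereal s < \<phi> (fst w)"
        using ereal_dense2 by blast
      have "\<phi> (fst w) \<le> Liminf (at (fst w) within V) \<phi>"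
        using \<phi> wV by (auto simp: Gamma0_def)
      then have "\<forall>\<^sub>F y in at (fst w) within V. ereal s < \<phi> y"
        using s(2) by (intro less_LiminfD) (rule less_le_trans)
      then have "\<forall>\<^sub>F y in nhds (fst w). y \<in> V \<longrightarrow> ereal s < \<phi> y"
        unfolding eventually_at_filter
      proof eventually_elim
        case (elim y)
        then show ?case using s(2) by (cases "y = fst w") auto
      qed
      then have "\<forall>\<^sub>F n in sequentially. fst (z n) \<in> V \<longrightarrow> ereal s < \<phi> (fst (z n))"
        by (rule eventually_compose_filterlim[OF _ lim1])
      moreover have "\<forall>\<^sub>F n in sequentially. snd (z n) < s"
        using s(1) by (intro order_tendstoD(2)[OF lim2]) simp
      ultimately have "\<forall>\<^sub>F n in sequentially. False"
      proof eventually_elim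
        case (elim n)
        then have "ereal s < ereal (?h (fst (z n)))" using zV real[OF zD(1)] by simp
        then show ?case using zD(2)[of n] elim by simp
      qed
      then show False by simp
    qed
    moreover from this have "fst w \<in> ?D" using wV by (auto simp: eff_dom_def)
    ultimately have "?h (fst w) \<le> snd w" using real[of "fst w"] by (metis ereal_less_eq(3))
    then show "w \<in> epigraph ?D ?h" using \<open>fst w \<in> ?D\<close> by (simp add: epigraph_def)
  qed
  moreover have "?D \<noteq> {}" using \<phi> by (simp add: Gamma0_def)
  ultimately show ?thesis by (simp add: closed_convex_fun_def)
qed

lemma minorant_if_minorant_outside_ball:
  fixes h :: "'a::real_inner \<Rightarrow> real"
  assumes h: "closed_convex_fun D h"
    and out: "\<And>x. x \<in> D \<Longrightarrow> r \<le> norm x \<Longrightarrow> x \<bullet> u \<le> h x"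
  shows "\<exists>c. \<forall>x\<in>D. x \<bullet> u - c \<le> h x"
proof -
  obtain c where c: "c \<ge> 0" "\<And>x. x \<in> D \<Longrightarrow> - c * (1 + norm x) \<le> h x"
    using closed_convex_fun_lower_bound[OF h] by blast
  define C where "C = c * (1 + \<bar>r\<bar>) + \<bar>r\<bar> * norm u"
  have "C \<ge> 0" using c(1) by (simp add: C_def)
  have "x \<bullet> u - C \<le> h x" if x: "x \<in> D" for x
  proof (cases "r \<le> norm x")
    case True
    then show ?thesis using out[OF x] \<open>C \<ge> 0\<close> by simp
  next
    case False
    then have r: "norm x \<le> \<bar>r\<bar>" by simp
    have "x \<bullet> u \<le> \<bar>r\<bar> * norm u"
      by (rule order_trans[OF norm_cauchy_schwarz]) (intro mult_right_mono r norm_ge_zero)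
    moreover have "c * (1 + norm x) \<le> c * (1 + \<bar>r\<bar>)" using c(1) r by (intro mult_left_mono) auto
    ultimately show ?thesis using c(2)[OF x] by (simp add: C_def)
  qed
  then show ?thesis by blast
qed

text \<open>
  Subtracting a linear function preserves uniform convexity, so it suffices to bound
  \<open>k x = \<phi> x - x \<bullet> u\<close> from below. A segment from \<open>y0\<close> to a far point \<open>x\<close> is divided into \<open>n\<close> pieces of
  length between 1 and 2. Then every second difference of \<open>k\<close> along the nodes is at least \<open>\<delta> / 2\<close>
  for some \<open>0 < \<delta> < \<theta> 2\<close>, while the first difference is bounded below, because \<open>k\<close> is bounded
  below near \<open>y0\<close>. Summation gives a quadratic lower bound in \<open>n\<close>.
\<close>

lemma uniformly_convex_affine_minorant:
  fixes \<phi> :: "'a::{real_inner,banach} \<Rightarrow> ereal"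
  assumes V: "hilbert_subspace V" and \<phi>: "Gamma0 V \<phi>" and uc: "uniformly_convex V \<phi>"
  shows "\<exists>c. \<forall>x\<in>eff_dom V \<phi>. x \<bullet> u - c \<le> real_of_ereal (\<phi> x)"
proof -
  let ?D = "eff_dom V \<phi>" and ?h = "\<lambda>x. real_of_ereal (\<phi> x)"
  note real = Gamma0_ereal_real[OF \<phi>]
  have h: "closed_convex_fun ?D ?h" by (rule Gamma0_closed_convex_fun[OF V \<phi>])
  then have cvD: "convex ?D" by (simp add: closed_convex_fun_def convex_on_def)
  obtain \<theta> :: "real \<Rightarrow> ereal" where \<theta>: "mono_on {0..} \<theta>" "\<forall>t\<ge>0. 0 \<le> \<theta> t \<and> (\<theta> t = 0 \<longleftrightarrow> t = 0)"
    "\<forall>x\<in>?D. \<forall>y\<in>?D. \<forall>\<alpha>\<in>{0<..<1}.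
      \<phi> (\<alpha> *\<^sub>R x + (1 - \<alpha>) *\<^sub>R y) + ereal (\<alpha> * (1 - \<alpha>)) * \<theta> (norm (x - y))
        \<le> ereal \<alpha> * \<phi> x + ereal (1 - \<alpha>) * \<phi> y"
    using uc unfolding uniformly_convex_def by blast
  have "0 < \<theta> 2" using \<theta>(2) by (metis order_le_less zero_le_numeral zero_neq_numeral)
  then obtain \<delta> where \<delta>: "0 < ereal \<delta>" "ereal \<delta> < \<theta> 2" using ereal_dense2 by blast
  have \<delta>0: "\<delta> > 0" using \<delta> by simp
  define k where "k x = ?h x - x \<bullet> u" for x
  have mid: "2 * k ((1/2) *\<^sub>R (x + y)) + \<delta> / 2 \<le> k x + k y"
    if xy: "x \<in> ?D" "y \<in> ?D" "2 \<le> norm (x - y)" for x y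
  proof -
    let ?q = "(1/2) *\<^sub>R x + (1 - 1/2) *\<^sub>R y"
    have qD: "?q \<in> ?D" using xy cvD by (intro convexD) auto
    have "\<theta> 2 \<le> \<theta> (norm (x - y))" using xy(3) by (intro mono_onD[OF \<theta>(1)]) auto
    then have "ereal \<delta> \<le> \<theta> (norm (x - y))" using \<delta>(2) by order
    then have "ereal (1/2 * (1 - 1/2)) * ereal \<delta> \<le> ereal (1/2 * (1 - 1/2)) * \<theta> (norm (x - y))"
      by (intro ereal_mult_left_mono) auto
    then have "\<phi> ?q + ereal (1/2 * (1 - 1/2)) * ereal \<delta>
        \<le> \<phi> ?q + ereal (1/2 * (1 - 1/2)) * \<theta> (norm (x - y))"
      by (rule add_left_mono)
    also have "\<dots> \<le> ereal (1/2) * \<phi> x + ereal (1 - 1/2) * \<phi> y"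
      using bspec[OF bspec[OF bspec[OF \<theta>(3) xy(1)] xy(2)], of "1/2"] by simp
    also have "\<dots> = ereal (1/2 * ?h x + (1 - 1/2) * ?h y)"
      by (subst real[OF xy(1)], subst real[OF xy(2)]) simp
    finally have "?h ?q + 1/2 * (1 - 1/2) * \<delta> \<le> 1/2 * ?h x + (1 - 1/2) * ?h y"
      by (subst (asm) real[OF qD]) simp
    moreover have "?q = (1/2) *\<^sub>R (x + y)" by (simp add: scaleR_add_right)
    ultimately show ?thesis by (simp add: k_def inner_add_left field_simps)
  qed
  obtain c where c: "c \<ge> 0" "\<And>x. x \<in> ?D \<Longrightarrow> - c * (1 + norm x) \<le> ?h x"
    using closed_convex_fun_lower_bound[OF h] by blast
  define c' where "c' = c + norm u"
  have c'0: "c' \<ge> 0" using c by (simp add: c'_def)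
  have kc: "- c' * (1 + norm x) \<le> k x" if "x \<in> ?D" for x
  proof -
    have "c' * (1 + norm x) = c * (1 + norm x) + norm u + norm x * norm u"
      by (simp add: c'_def algebra_simps)
    moreover have "- (c * (1 + norm x)) \<le> ?h x" using c(2)[OF that] by simp
    ultimately show ?thesis
      using norm_cauchy_schwarz[of x u] norm_ge_zero[of u] unfolding k_def by linarith
  qed
  obtain y0 where y0: "y0 \<in> ?D" using \<phi> by (auto simp: Gamma0_def)
  define m where "m = c' * (3 + norm y0)"
  have near: "- m \<le> k x" if "x \<in> ?D" "norm (x - y0) \<le> 2" for x
  proof -
    have "1 + norm x \<le> 3 + norm y0" using norm_triangle_sub[of x y0] that(2) by simp
    then have "c' * (1 + norm x) \<le> m" unfolding m_def using c'0 by (rule mult_left_mono)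
    then show ?thesis using kc[OF that(1)] by simp
  qed
  define b where "b = m + k y0 + \<delta> / 4"
  have far: "k y0 - b\<^sup>2 / \<delta> \<le> k x" if x: "x \<in> ?D" and r: "1 \<le> norm (x - y0)" for x
  proof -
    define n where "n = nat \<lfloor>norm (x - y0)\<rfloor>"
    have n: "real n \<le> norm (x - y0)" "norm (x - y0) < real n + 1" "1 \<le> n"
      using r by (auto simp: n_def le_nat_floor)
    define e where "e = (1 / real n) *\<^sub>R (x - y0)"
    have e: "1 \<le> norm e" "norm e \<le> 2"
    proof -
      have "norm e = norm (x - y0) / real n" by (simp add: e_def)
      then show "1 \<le> norm e" "norm e \<le> 2"
        using n by (simp_all add: pos_le_divide_eq pos_divide_le_eq)
    qed
    define y where "y j = y0 + real j *\<^sub>R e" for j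
    have yD: "y j \<in> ?D" if "j \<le> n" for j
    proof -
      define t where "t = real j / real n"
      have t: "0 \<le> t" "t \<le> 1" using that n by (auto simp: t_def)
      have "y j = (1 - t) *\<^sub>R y0 + t *\<^sub>R x"
        by (simp add: y_def e_def t_def algebra_simps)
      then show ?thesis using t x y0 cvD by (auto intro!: convexD)
    qed
    have yn: "y n = x" using n by (simp add: y_def e_def)
    have ysum: "(1/2) *\<^sub>R (y j + y (Suc (Suc j))) = y (Suc j)" for j
      by (simp add: y_def algebra_simps flip: scaleR_add_left)
    have ydiff: "2 \<le> norm (y (Suc (Suc j)) - y j)" for j
    proof -
      have "y (Suc (Suc j)) - y j = 2 *\<^sub>R e" by (simp add: y_def algebra_simps flip: scaleR_add_left)
      then show ?thesis using e(1) by simp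
    qed
    have first: "- m - k y0 \<le> k (y 1) - k (y 0)"
      using near[OF yD[of 1]] n(3) e(2) by (simp add: y_def)
    (* Consecutive nodes y j and y (j + 2) are at distance at least 2, so each midpoint
       inequality raises the slope by delta / 2. *)
    have slope: "- m - k y0 + real j * (\<delta> / 2) \<le> k (y (Suc j)) - k (y j)" if "j < n" for j
      using that
    proof (induction j)
      case 0
      then show ?case using first by simp
    next
      case (Suc j)
      have "2 * k (y (Suc j)) + \<delta> / 2 \<le> k (y j) + k (y (Suc (Suc j)))"
        using mid[OF yD yD, of j "Suc (Suc j)"] ydiff[of j] Suc.prems
        by (simp add: ysum norm_minus_commute)
      moreover have "- m - k y0 + real j * (\<delta> / 2) \<le> k (y (Suc j)) - k (y j)"
        using Suc by simp
      moreover have "real (Suc j) * (\<delta> / 2) = real j * (\<delta> / 2) + \<delta> / 2"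
        by (simp add: distrib_right)
      ultimately show ?case by linarith
    qed
    have "k (y 0) - real j * b + \<delta> / 4 * (real j)\<^sup>2 \<le> k (y j)" if "j \<le> n" for j
      using that
    proof (induction j)
      case (Suc j)
      then have "k (y 0) - real j * b + \<delta> / 4 * (real j)\<^sup>2 \<le> k (y j)" by simp
      then show ?case
        using slope[of j] Suc.prems by (simp add: b_def algebra_simps power2_eq_square add_divide_distrib)
    qed simp
    from this[of n] have "k y0 - real n * b + \<delta> / 4 * (real n)\<^sup>2 \<le> k x"
      using yn by (simp add: y_def)
    moreover have "0 \<le> (\<delta> * real n / 2 - b)\<^sup>2 / \<delta>" using \<delta>0 by simp
    then have "0 \<le> \<delta> / 4 * (real n)\<^sup>2 - real n * b + b\<^sup>2 / \<delta>"
      using \<delta>0 by (simp add: power2_eq_square field_simps)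
    ultimately show ?thesis by linarith
  qed
  have "x \<bullet> u - (\<bar>m\<bar> + \<bar>k y0 - b\<^sup>2 / \<delta>\<bar>) \<le> ?h x" if x: "x \<in> ?D" for x
  proof (cases "1 \<le> norm (x - y0)")
    case True
    then show ?thesis using far[OF x] by (simp add: k_def)
  next
    case False
    then show ?thesis using near[OF x] by (simp add: k_def)
  qed
  then show ?thesis by blast
qed

text \<open>
  What the alternatives have in common: every \<open>u\<close> is the slope of an affine minorant of \<open>\<phi>\<close>,
  i.e. the conjugate is finite everywhere. This is weaker than supercoercivity in infinite
  dimension, but combined with uniform boundedness it bounds the approximate solutions.
\<close>

lemma affine_minorant_every_slope:
  fixes \<phi> :: "'a::{real_inner,banach} \<Rightarrow> ereal"
  assumes V: "hilbert_subspace V" and \<phi>: "Gamma0 V \<phi>" and u: "u \<in> V"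
    and alt: "op_ran (subdiff V \<phi>) = V \<or> supercoercive V \<phi> \<or> bounded (eff_dom V \<phi>) \<or> uniformly_convex V \<phi>"
  shows "\<exists>c. \<forall>x\<in>eff_dom V \<phi>. x \<bullet> u - c \<le> real_of_ereal (\<phi> x)"
  using alt
proof (elim disjE)
  let ?D = "eff_dom V \<phi>"
  note real = Gamma0_ereal_real[OF \<phi>]
  have h: "closed_convex_fun ?D (\<lambda>x. real_of_ereal (\<phi> x))"
    by (rule Gamma0_closed_convex_fun[OF V \<phi>])
  show ?thesis if "op_ran (subdiff V \<phi>) = V"
  proof -
    obtain x where x: "u \<in> subdiff V \<phi> x"
      using \<open>op_ran (subdiff V \<phi>) = V\<close> u by (auto simp: op_ran_def)
    then have xV: "x \<in> V" and le: "\<And>y. y \<in> V \<Longrightarrow> ereal ((y - x) \<bullet> u) + \<phi> x \<le> \<phi> y"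
      by (auto simp: subdiff_def)
    obtain y0 where y0: "y0 \<in> ?D" using \<phi> by (auto simp: Gamma0_def)
    then have "\<phi> x < \<infinity>" using le[of y0] by (cases "\<phi> x") (auto simp: eff_dom_def)
    then have xD: "x \<in> ?D" using xV by (simp add: eff_dom_def)
    have "y \<bullet> u - (x \<bullet> u - real_of_ereal (\<phi> x)) \<le> real_of_ereal (\<phi> y)" if y: "y \<in> ?D" for y
    proof -
      have "ereal ((y - x) \<bullet> u) + \<phi> x \<le> \<phi> y" using le y by (simp add: eff_dom_def)
      then have "(y - x) \<bullet> u + real_of_ereal (\<phi> x) \<le> real_of_ereal (\<phi> y)"
        by (subst (asm) real[OF xD], subst (asm) real[OF y]) simp
      then show ?thesis by (simp add: inner_diff_left)
    qed
    then show ?thesis by blast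
  qed
  show ?thesis if "supercoercive V \<phi>"
  proof -
    have "\<forall>\<^sub>F x in inf at_infinity (principal V). ereal (norm u) < \<phi> x / ereal (norm x)"
      using that unfolding supercoercive_def tendsto_PInfty by blast
    then obtain r where r: "\<And>x. r \<le> norm x \<Longrightarrow> x \<in> V \<Longrightarrow> ereal (norm u) < \<phi> x / ereal (norm x)"
      unfolding eventually_inf_principal eventually_at_infinity by blast
    show ?thesis
    proof (rule minorant_if_minorant_outside_ball[OF h])
      fix x assume x: "x \<in> ?D" "max r 1 \<le> norm x"
      then have "ereal (norm u) < \<phi> x / ereal (norm x)" using r by (simp add: eff_dom_def)
      moreover have pos: "0 < norm x" using x(2) by linarith
      ultimately have "norm u < real_of_ereal (\<phi> x) / norm x"
        by (subst (asm) real[OF x(1)]) simp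
      then have "norm u * norm x < real_of_ereal (\<phi> x)"
        using pos by (simp add: pos_less_divide_eq)
      then show "x \<bullet> u \<le> real_of_ereal (\<phi> x)"
        using norm_cauchy_schwarz[of x u] by (simp add: mult.commute)
    qed
  qed
  show ?thesis if bd: "bounded ?D"
  proof -
    obtain r where "\<And>x. x \<in> ?D \<Longrightarrow> norm x \<le> r" using bd by (auto simp: bounded_iff)
    then show ?thesis
      by (intro minorant_if_minorant_outside_ball[OF h, of "r + 1"]) force
  qed
  show ?thesis if "uniformly_convex V \<phi>"
    by (rule uniformly_convex_affine_minorant[OF V \<phi> that])
qed

section \<open>Subgradients and gradients relative to a subspace\<close>

text \<open>
  Back from the real-valued description: outside the effective domain the subgradient
  inequality is trivial.
\<close>

lemma ereal_subgradient:
  assumes \<phi>: "Gamma0 V \<phi>" and x: "x \<in> eff_dom V \<phi>"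
    and sg: "\<And>y. y \<in> eff_dom V \<phi> \<Longrightarrow> real_of_ereal (\<phi> x) + (y - x) \<bullet> s \<le> real_of_ereal (\<phi> y)"
    and y: "y \<in> V"
  shows "ereal ((y - x) \<bullet> s) + \<phi> x \<le> \<phi> y"
proof (cases "\<phi> y = \<infinity>")
  case False
  then have yD: "y \<in> eff_dom V \<phi>" using y by (simp add: eff_dom_def less_top)
  show ?thesis
    using sg[OF yD]
    by (subst Gamma0_ereal_real[OF \<phi> x], subst Gamma0_ereal_real[OF \<phi> yD]) simp
qed simp

text \<open>
  The Fenchel-Young equality at \<open>x\<close> exhibits \<open>x\<close> as a slope of the conjugate at \<open>v\<close>.
\<close>

lemma subdiff_fenchel_conj:
  assumes \<phi>: "Gamma0 V \<phi>" and x: "x \<in> eff_dom V \<phi>" and v: "v \<in> V"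
    and sg: "\<And>y. y \<in> V \<Longrightarrow> ereal ((y - x) \<bullet> v) + \<phi> x \<le> \<phi> y"
  shows "x \<in> subdiff V (fenchel_conj V \<phi>) v"
proof -
  have xV: "x \<in> V" using x by (simp add: eff_dom_def)
  obtain r where r: "\<phi> x = ereal r" using Gamma0_ereal_real[OF \<phi> x] by blast
  have le: "fenchel_conj V \<phi> v \<le> ereal (x \<bullet> v - r)"
    unfolding fenchel_conj_def
  proof (rule SUP_least)
    fix y assume "y \<in> V"
    then show "ereal (y \<bullet> v) - \<phi> y \<le> ereal (x \<bullet> v - r)"
      using sg[of y] by (cases "\<phi> y") (auto simp: r inner_diff_left)
  qed
  have "ereal ((w - v) \<bullet> x) + fenchel_conj V \<phi> v \<le> fenchel_conj V \<phi> w" if "w \<in> V" for w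
  proof -
    have "ereal ((w - v) \<bullet> x) + fenchel_conj V \<phi> v \<le> ereal ((w - v) \<bullet> x) + ereal (x \<bullet> v - r)"
      using le by (rule add_left_mono)
    also have "\<dots> = ereal (x \<bullet> w) - \<phi> x"
      by (simp add: r inner_diff_left inner_diff_right inner_commute[of _ x])
    also have "\<dots> \<le> fenchel_conj V \<phi> w"
      unfolding fenchel_conj_def by (rule SUP_upper[OF xV])
    finally show ?thesis .
  qed
  then show ?thesis using v xV by (simp add: subdiff_def)
qed

lemma directional_derivative_within_subspace:
  fixes F :: "'a::real_inner \<Rightarrow> real"
  assumes F: "(F has_derivative (\<lambda>h. h \<bullet> g)) (at p within V)" and V: "subspace V"
    and pd: "p \<in> V" "d \<in> V"
  shows "((\<lambda>t. F (p + t *\<^sub>R d)) has_real_derivative d \<bullet> g) (at 0)"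
proof -
  have line: "((\<lambda>t. p + t *\<^sub>R d) has_derivative (\<lambda>t. t *\<^sub>R d)) (at 0)"
    by (auto intro!: derivative_eq_intros)
  have "range (\<lambda>t. p + t *\<^sub>R d) \<subseteq> V"
    using V pd by (auto intro: subspace_add subspace_scale)
  then have "(F has_derivative (\<lambda>h. h \<bullet> g)) (at (p + 0 *\<^sub>R d) within range (\<lambda>t. p + t *\<^sub>R d))"
    using has_derivative_subset[OF F] by simp
  from has_derivative_in_compose[OF line this]
  show ?thesis by (simp add: has_field_derivative_def mult_commute_abs)
qed

text \<open>
  The derivative within \<open>V\<close> is only determined along \<open>V\<close>, so a derivative given as a functional
  on the whole space is first restricted to \<open>V\<close> and then represented there.
\<close>

lemma ex1_gradient_within_subspace:
  fixes F :: "'a::{real_inner,banach} \<Rightarrow> real"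
  assumes V: "hilbert_subspace V" and F: "F differentiable_on V" and p: "p \<in> V"
  shows "\<exists>!g. g \<in> V \<and> (F has_derivative (\<lambda>h. h \<bullet> g)) (at p within V)"
proof -
  have sub: "subspace V" using V by (simp add: hilbert_subspace_def)
  obtain F' where F': "(F has_derivative F') (at p within V)"
    using F p unfolding differentiable_on_def differentiable_def by blast
  then interpret F': bounded_linear F' by (rule has_derivative_bounded_linear)
  obtain K where "\<And>x. norm (F' x) \<le> norm x * K" using F'.bounded by blast
  then have "\<exists>!g. g \<in> V \<and> (\<forall>x\<in>V. F' x = x \<bullet> g)"
    by (intro riesz_representation[OF V, of F' K])
      (auto simp: F'.add F'.scaleR mult.commute)
  then obtain g where g: "g \<in> V" "\<And>x. x \<in> V \<Longrightarrow> F' x = x \<bullet> g" by blast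
  have lim: "((\<lambda>y. (1 / norm (y - p)) *\<^sub>R (F y - (F p + F' (y - p)))) \<longlongrightarrow> 0) (at p within V)"
    using F' by (simp add: has_derivative_within)
  have "((\<lambda>y. (1 / norm (y - p)) *\<^sub>R (F y - (F p + (y - p) \<bullet> g))) \<longlongrightarrow> 0) (at p within V)"
  proof (rule Lim_transform_within[OF lim zero_less_one])
    fix y assume "y \<in> V"
    then have "F' (y - p) = (y - p) \<bullet> g" using g(2) p sub by (simp add: subspace_diff)
    then show "(1 / norm (y - p)) *\<^sub>R (F y - (F p + F' (y - p)))
        = (1 / norm (y - p)) *\<^sub>R (F y - (F p + (y - p) \<bullet> g))" by simp
  qed
  then have der: "(F has_derivative (\<lambda>h. h \<bullet> g)) (at p within V)"
    by (simp add: has_derivative_within bounded_linear_inner_left)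
  show ?thesis
  proof (rule ex1I[of _ g])
    fix g' assume g': "g' \<in> V \<and> (F has_derivative (\<lambda>h. h \<bullet> g')) (at p within V)"
    then have d: "g' - g \<in> V" using g sub by (simp add: subspace_diff)
    have "(g' - g) \<bullet> g' = (g' - g) \<bullet> g"
      using directional_derivative_within_subspace[OF _ sub p d] g' der by (blast intro: DERIV_unique)
    then have "(g' - g) \<bullet> (g' - g) = 0" by (simp add: inner_diff_right)
    then show "g' = g" by simp
  qed (use g der in auto)
qed

lemma convex_gradient_inequality:
  fixes F :: "'a::{real_inner,banach} \<Rightarrow> real"
  assumes V: "hilbert_subspace V" and cv: "convex_on V F"
    and F: "(F has_derivative (\<lambda>h. h \<bullet> g)) (at p within V)" and p: "p \<in> V" and u: "u \<in> V"
  shows "F p + (u - p) \<bullet> g \<le> F u"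
proof -
  have sub: "subspace V" using V by (simp add: hilbert_subspace_def)
  have d: "u - p \<in> V" using p u sub by (simp add: subspace_diff)
  have "((\<lambda>t. (F (p + t *\<^sub>R (u - p)) - F p) / t) \<longlongrightarrow> (u - p) \<bullet> g) (at 0)"
    using directional_derivative_within_subspace[OF F sub p d]
    by (simp add: has_field_derivative_iff)
  then have lim: "((\<lambda>t. (F (p + t *\<^sub>R (u - p)) - F p) / t) \<longlongrightarrow> (u - p) \<bullet> g) (at_right 0)"
    by (rule filterlim_mono[OF _ order_refl at_le]) simp
  have "(F (p + t *\<^sub>R (u - p)) - F p) / t \<le> F u - F p" if t: "0 < t" "t < 1" for t
  proof -
    have "F ((1 - t) *\<^sub>R p + t *\<^sub>R u) \<le> (1 - t) * F p + t * F u"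
      using t p u by (intro convex_onD[OF cv]) auto
    moreover have "(1 - t) *\<^sub>R p + t *\<^sub>R u = p + t *\<^sub>R (u - p)" by (simp add: algebra_simps)
    ultimately have "F (p + t *\<^sub>R (u - p)) - F p \<le> (F u - F p) * t"
      by (simp add: left_diff_distrib right_diff_distrib mult.commute)
    then show ?thesis using t by (simp add: pos_divide_le_eq)
  qed
  then have "\<forall>\<^sub>F t in at_right 0. (F (p + t *\<^sub>R (u - p)) - F p) / t \<le> F u - F p"
    unfolding eventually_at_right_field by (intro exI[of _ 1]) auto
  from tendsto_upperbound[OF lim this] show ?thesis by simp
qed

section \<open>Direct sums and the Nash equilibrium problem\<close>

lemma hilbert_subspace_hilbert_sum:
  assumes "\<And>j. j \<in> J \<Longrightarrow> hilbert_subspace (S j)"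
  shows "hilbert_subspace (hilbert_sum J S)"
proof -
  define T where "T j = (if j \<in> J then S j else {0})" for j
  have T: "hilbert_subspace (T j)" for j
    using assms by (auto simp: T_def hilbert_subspace_def)
  have eq: "hilbert_sum J S = (\<Inter>j. (\<lambda>x. x $ j) -` T j)"
    by (auto simp: hilbert_sum_def T_def split: if_splits)
  have "closed (hilbert_sum J S)"
    unfolding eq using T
    by (intro closed_INT ballI closed_vimage continuous_on_component continuous_on_id)
      (simp add: hilbert_subspace_def)
  moreover have "subspace (hilbert_sum J S)"
    using T unfolding eq hilbert_subspace_def subspace_def by auto
  ultimately show ?thesis by (simp add: hilbert_subspace_def)
qed

lemma replace_comp_diff: "replace_comp i u x - (x :: 'a::ab_group_add ^ 'i::finite) = axis i (u - x $ i)"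
  by (simp add: vec_eq_iff replace_comp_def axis_def)

lemma replace_comp_same: "replace_comp i (x $ i) x = x"
  by (simp add: vec_eq_iff replace_comp_def)

lemma replace_comp_nth: "replace_comp i u x $ j = (if j = i then u else x $ j)"
  by (simp add: replace_comp_def)

lemma sum_replace_comp:
  fixes h :: "'i::finite \<Rightarrow> 'a \<Rightarrow> real"
  shows "(\<Sum>j\<in>UNIV. h j (replace_comp i u x $ j)) = (\<Sum>j\<in>UNIV. h j (x $ j)) + h i u - h i (x $ i)"
proof -
  have "(\<Sum>j\<in>UNIV. h j (replace_comp i u x $ j)) = h i u + (\<Sum>j\<in>UNIV - {i}. h j (x $ j))"
    by (subst sum.remove[of _ i]) (auto simp: replace_comp_nth intro!: sum.cong)
  moreover have "(\<Sum>j\<in>UNIV. h j (x $ j)) = h i (x $ i) + (\<Sum>j\<in>UNIV - {i}. h j (x $ j))"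
    by (subst sum.remove[of _ i]) auto
  ultimately show ?thesis by simp
qed

theorem proposition4p2:
  fixes H :: "'i::finite \<Rightarrow> 'a::{real_inner,banach} set"
    and K :: "'k::finite set"
    and G :: "'k \<Rightarrow> 'b::{real_inner,banach} set"
    and \<phi> :: "'i \<Rightarrow> 'a \<Rightarrow> ereal"
    and f :: "'i \<Rightarrow> 'a ^ 'i \<Rightarrow> real"
    and g :: "'k \<Rightarrow> 'b \<Rightarrow> ereal"
    and L :: "'k \<Rightarrow> 'a ^ 'i \<Rightarrow> 'b"
  assumes H: "\<And>i. hilbert_subspace (H i)"
    and G: "\<And>k. k \<in> K \<Longrightarrow> hilbert_subspace (G k)"
    and a: "\<And>i. Gamma0 (H i) (\<phi> i)"
    and b_convex: "\<And>i x. x \<in> hilbert_sum UNIV H \<Longrightarrow>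
        convex_on (H i) (\<lambda>u. f i (replace_comp i u x))"
    and b_diff: "\<And>i x. x \<in> hilbert_sum UNIV H \<Longrightarrow>
        (\<lambda>u. f i (replace_comp i u x)) differentiable_on (H i)"
    and b_mono: "monotone_op (sv_op (hilbert_sum UNIV H) (pseudo_gradient H f))"
    and b_lip: "\<exists>M. lipschitz_on M (hilbert_sum UNIV H) (pseudo_gradient H f)"
    and c_g: "\<And>k. k \<in> K \<Longrightarrow> Gamma0 (G k) (g k)"
    and c_L: "\<And>k. k \<in> K \<Longrightarrow> bounded_linear_between (hilbert_sum UNIV H) (G k) (L k)"
    and sri: "0 \<in> sri (qualification_set H \<phi> K G g L)"
    and alternatives:
      "(\<forall>i. op_ran (subdiff (H i) (\<phi> i)) = H i
           \<or> supercoercive (H i) (\<phi> i)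
           \<or> bounded (eff_dom (H i) (\<phi> i))
           \<or> uniformly_convex (H i) (\<phi> i))
       \<or> (three_star_monotone (sv_op (hilbert_sum UNIV H) (pseudo_gradient H f))
           \<and> op_ran (sv_op (hilbert_sum UNIV H) (pseudo_gradient H f)) = hilbert_sum UNIV H)"
  shows "primal_dual_set H \<phi> f K G g L \<noteq> {} \<and>
    (\<exists>x \<in> hilbert_sum UNIV H. \<forall>i.
       x $ i \<in> Argmin (H i)
         (\<lambda>u. \<phi> i u + ereal (f i (replace_comp i u x))
              + (\<Sum>k\<in>K. g k (L k (replace_comp i u x)))))"
proof -
  define HH where "HH = hilbert_sum UNIV H"
  define GG where "GG = hilbert_sum K G"
  define B where "B = pseudo_gradient H f"
  have HH: "hilbert_subspace HH"
    unfolding HH_def by (intro hilbert_subspace_hilbert_sum H)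
  have GG: "hilbert_subspace GG"
    unfolding GG_def by (intro hilbert_subspace_hilbert_sum G)
  have subH: "subspace HH" and subHi: "subspace (H i)" for i
    using HH H by (auto simp: hilbert_subspace_def)
  have HH_nth: "x $ i \<in> H i" if "x \<in> HH" for x i
    using that by (simp add: HH_def hilbert_sum_def)
  have replace_HH: "replace_comp i u x \<in> HH" if "x \<in> HH" "u \<in> H i" for x i u
    using that by (auto simp: HH_def hilbert_sum_def replace_comp_nth)

  have grad: "B x $ i \<in> H i"
    "((\<lambda>u. f i (replace_comp i u x)) has_derivative (\<lambda>h. h \<bullet> B x $ i)) (at (x $ i) within H i)"
    if x: "x \<in> HH" for x i
    using theI'[OF ex1_gradient_within_subspace[OF H b_diff[OF x[unfolded HH_def]] HH_nth[OF x]]]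
    by (simp_all add: B_def pseudo_gradient_def partial_gradient_def)
  have BH: "B x \<in> HH" if "x \<in> HH" for x
    using grad(1)[OF that] by (simp add: HH_def hilbert_sum_def)
  have Bmono: "0 \<le> (x - y) \<bullet> (B x - B y)" if "x \<in> HH" "y \<in> HH" for x y
    using b_mono that by (auto simp: monotone_op_def op_gra_def sv_op_def HH_def B_def)
  obtain M where Blip: "lipschitz_on M HH B"
    using b_lip by (auto simp: HH_def B_def)

  define D\<phi> where "D\<phi> i = eff_dom (H i) (\<phi> i)" for i
  define h\<phi> where "h\<phi> i x = real_of_ereal (\<phi> i x)" for i x
  (* Indices outside K get the domain {0} and the function 0, so that GG is covered by sums over
     the whole index type. *)
  define Dg where "Dg k = (if k \<in> K then eff_dom (G k) (g k) else {0})" for k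
  define hg where "hg k y = (if k \<in> K then real_of_ereal (g k y) else 0)" for k y
  define D where "D = {x. \<forall>i. x $ i \<in> D\<phi> i}"
  define E where "E = {y. \<forall>k. y $ k \<in> Dg k}"
  define F where "F x = (\<Sum>i\<in>UNIV. h\<phi> i (x $ i))" for x
  define \<Psi> where "\<Psi> y = (\<Sum>k\<in>UNIV. hg k (y $ k))" for y
  define LL where "LL x = (\<chi> k. if k \<in> K then L k x else 0)" for x
  have F: "closed_convex_fun D F"
    unfolding D_def F_def D\<phi>_def h\<phi>_def
    by (intro closed_convex_fun_sum_components Gamma0_closed_convex_fun H a)
  have "closed_convex_fun (Dg k) (hg k)" for k
  proof (cases "k \<in> K")
    case True
    then have "hg k = (\<lambda>y. real_of_ereal (g k y))" by (simp add: hg_def fun_eq_iff)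
    with True show ?thesis
      using Gamma0_closed_convex_fun[OF G c_g, of k] by (simp add: Dg_def)
  next
    case False
    then have "hg k = (\<lambda>y. 0)" by (simp add: hg_def fun_eq_iff)
    with False show ?thesis
      using closed_convex_fun_const[of "{0 :: 'b}" 0] by (simp add: Dg_def)
  qed
  then have \<Psi>: "closed_convex_fun E \<Psi>"
    unfolding E_def \<Psi>_def by (intro closed_convex_fun_sum_components)
  have DH: "D \<subseteq> HH"
    by (auto simp: D_def D\<phi>_def HH_def hilbert_sum_def eff_dom_def)
  have EG: "E \<subseteq> GG"
  proof
    fix y assume y: "y \<in> E"
    have yk: "y $ k \<in> Dg k" for k using y by (simp add: E_def)
    have "y $ k \<in> G k" if "k \<in> K" for k
      using yk[of k] that by (simp add: Dg_def eff_dom_def)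
    moreover have "y $ k = 0" if "k \<notin> K" for k
      using yk[of k] that by (simp add: Dg_def)
    ultimately show "y \<in> GG" by (simp add: GG_def hilbert_sum_def)
  qed
  have LL: "bounded_linear_between HH GG LL"
    unfolding bounded_linear_between_def
  proof (intro conjI)
    note Llin = bounded_linear_betweenD[OF c_L[folded HH_def] subH]
    show "LL \<in> HH \<rightarrow> GG" using Llin(1) by (auto simp: LL_def GG_def hilbert_sum_def)
    show "\<forall>x\<in>HH. \<forall>y\<in>HH. LL (x + y) = LL x + LL y"
      by (auto simp: LL_def vec_eq_iff Llin)
    show "\<forall>x\<in>HH. \<forall>c. LL (c *\<^sub>R x) = c *\<^sub>R LL x"
      by (auto simp: LL_def vec_eq_iff Llin)
    have "\<forall>k. \<exists>b. k \<in> K \<longrightarrow> (\<forall>x\<in>HH. norm (L k x) \<le> b * norm x)"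
      using bounded_linear_between_bound[OF c_L[folded HH_def]] by metis
    then obtain b where b: "\<And>k x. k \<in> K \<Longrightarrow> x \<in> HH \<Longrightarrow> norm (L k x) \<le> b k * norm x"
      by metis
    have "norm (LL x) \<le> (\<Sum>k\<in>K. b k) * norm x" if x: "x \<in> HH" for x
    proof -
      have "norm (LL x) \<le> (\<Sum>k\<in>UNIV. norm (LL x $ k))"
        unfolding norm_vec_def by (rule L2_set_le_sum) simp
      also have "\<dots> = (\<Sum>k\<in>K. norm (L k x))"
        by (rule sum.mono_neutral_cong_right) (auto simp: LL_def)
      also have "\<dots> \<le> (\<Sum>k\<in>K. b k * norm x)" using b x by (intro sum_mono)
      finally show ?thesis by (simp add: sum_distrib_right)
    qed
    then show "\<exists>b. \<forall>x\<in>HH. norm (LL x) \<le> b * norm x" by blast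
  qed

  have C: "qualification_set H \<phi> K G g L = (\<lambda>z. LL (fst z) - snd z) ` (D \<times> E)"
  proof (intro set_eqI iffI)
    fix c assume "c \<in> qualification_set H \<phi> K G g L"
    then obtain x y where xy: "c = (\<chi> k. if k \<in> K then L k x - y k else 0)"
      "\<forall>i. x $ i \<in> eff_dom (H i) (\<phi> i)" "\<forall>k\<in>K. y k \<in> eff_dom (G k) (g k)"
      unfolding qualification_set_def by blast
    have "x \<in> D" using xy by (simp add: D_def D\<phi>_def)
    moreover have "(\<chi> k. if k \<in> K then y k else 0) \<in> E" using xy by (simp add: E_def Dg_def)
    moreover have "c = LL x - (\<chi> k. if k \<in> K then y k else 0)"
      by (simp add: xy(1) LL_def vec_eq_iff)
    ultimately show "c \<in> (\<lambda>z. LL (fst z) - snd z) ` (D \<times> E)"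
      by (intro image_eqI[of _ _ "(x, \<chi> k. if k \<in> K then y k else 0)"]) auto
  next
    fix c assume "c \<in> (\<lambda>z. LL (fst z) - snd z) ` (D \<times> E)"
    then obtain x y where xy: "c = LL x - y" "x \<in> D" "y \<in> E" by auto
    have yk: "y $ k \<in> Dg k" for k using xy(3) by (simp add: E_def)
    have "c = (\<chi> k. if k \<in> K then L k x - y $ k else 0)"
    proof -
      have "y $ k = 0" if "k \<notin> K" for k using yk[of k] that by (simp add: Dg_def)
      then show ?thesis by (simp add: xy(1) LL_def vec_eq_iff)
    qed
    moreover have "\<forall>k\<in>K. y $ k \<in> eff_dom (G k) (g k)"
    proof
      fix k assume "k \<in> K"
      then show "y $ k \<in> eff_dom (G k) (g k)" using yk[of k] by (simp add: Dg_def)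
    qed
    ultimately show "c \<in> qualification_set H \<phi> K G g L"
      using xy(2) unfolding qualification_set_def D_def D\<phi>_def by blast
  qed
  have cone: "hilbert_subspace (\<Union>r\<in>{0<..}. (\<lambda>z. r *\<^sub>R (LL (fst z) - snd z)) ` (D \<times> E))"
    using sri unfolding sri_def C by (simp add: image_image)
  have "0 \<in> (\<lambda>z. LL (fst z) - snd z) ` (D \<times> E)"
    using sri unfolding sri_def C by blast
  then obtain x0 where x0: "x0 \<in> D" "LL x0 \<in> E" by auto
  have x0H: "x0 \<in> HH" using x0 DH by blast

  have coercive: "\<exists>c. \<forall>x\<in>D. x \<bullet> w - c \<le> F x + (x - x0) \<bullet> B x" if w: "w \<in> HH" for w
    using alternatives
  proof
    assume alt: "\<forall>i. op_ran (subdiff (H i) (\<phi> i)) = H i \<or> supercoercive (H i) (\<phi> i)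
        \<or> bounded (eff_dom (H i) (\<phi> i)) \<or> uniformly_convex (H i) (\<phi> i)"
    (* Monotonicity bounds the coupling term from below by an affine function with slope B x0,
       and the minorant of slope w - B x0 compensates it. *)
    define w' where "w' = w - B x0"
    have "w' \<in> HH" using w BH[OF x0H] subH by (simp add: w'_def subspace_diff)
    then have "\<forall>i. \<exists>c. \<forall>x\<in>D\<phi> i. x \<bullet> w' $ i - c \<le> h\<phi> i x"
      unfolding D\<phi>_def h\<phi>_def using alt
      by (intro allI affine_minorant_every_slope H a HH_nth) auto
    then obtain c where c: "\<And>i x. x \<in> D\<phi> i \<Longrightarrow> x \<bullet> w' $ i - c i \<le> h\<phi> i x" by metis
    have "x \<bullet> w - (x0 \<bullet> B x0 + (\<Sum>i\<in>UNIV. c i)) \<le> F x + (x - x0) \<bullet> B x" if x: "x \<in> D" for x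
    proof -
      have "(\<Sum>i\<in>UNIV. x $ i \<bullet> w' $ i - c i) \<le> F x"
        unfolding F_def using x by (intro sum_mono c) (simp add: D_def)
      then have "x \<bullet> w' - (\<Sum>i\<in>UNIV. c i) \<le> F x"
        by (simp add: inner_vec_def sum_subtractf)
      moreover have "0 \<le> (x - x0) \<bullet> (B x - B x0)" using Bmono x DH x0H by blast
      ultimately show ?thesis by (simp add: w'_def inner_diff_left inner_diff_right)
    qed
    then show ?thesis by blast
  next
    assume alt: "three_star_monotone (sv_op (hilbert_sum UNIV H) (pseudo_gradient H f))
      \<and> op_ran (sv_op (hilbert_sum UNIV H) (pseudo_gradient H f)) = hilbert_sum UNIV H"
    obtain p where p: "p \<in> D" "\<And>y. y \<in> D \<Longrightarrow> (y - p) \<bullet> (0 - p) + F p \<le> F y"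
      using proximal_point_exists[OF F, of 0] by metis
    (* Here F only provides an affine minorant, with slope - p. Surjectivity allows to use
       u = w + p in the 3* condition, which makes up for both w and that slope. *)
    define u where "u = w + p"
    have "u \<in> op_ran (sv_op HH B)"
      using alt w p(1) DH subH by (auto simp: HH_def B_def u_def intro: subspace_add)
    moreover have "x0 \<in> op_dom (sv_op HH B)" using x0H by (simp add: op_dom_def sv_op_def)
    ultimately have fin: "(SUP (y, v)\<in>op_gra (sv_op HH B). ereal ((x0 - y) \<bullet> (v - u))) < \<infinity>"
      using alt by (auto simp: three_star_monotone_def HH_def B_def)
    have ub: "ereal ((x0 - y) \<bullet> (B y - u)) \<le> (SUP (y, v)\<in>op_gra (sv_op HH B). ereal ((x0 - y) \<bullet> (v - u)))"
      if "y \<in> HH" for y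
      using that by (intro SUP_upper2[of "(y, B y)"]) (auto simp: op_gra_def sv_op_def)
    obtain c where c': "(SUP (y, v)\<in>op_gra (sv_op HH B). ereal ((x0 - y) \<bullet> (v - u))) < ereal c"
      using ereal_dense2[OF fin] by blast
    have c: "(x0 - y) \<bullet> (B y - u) \<le> c" if "y \<in> HH" for y
    proof -
      have "ereal ((x0 - y) \<bullet> (B y - u)) < ereal c" by (rule le_less_trans[OF ub[OF that] c'])
      then show ?thesis by simp
    qed
    have "x \<bullet> w - (x0 \<bullet> u + c - p \<bullet> p - F p) \<le> F x + (x - x0) \<bullet> B x" if x: "x \<in> D" for x
      using p(2)[OF x] c[of x] x DH
      by (auto simp: u_def inner_diff_left inner_diff_right inner_add_right)
    then show ?thesis by blast
  qed

  obtain x v where x: "x \<in> D" and v: "v \<in> GG" and Lx: "LL x \<in> E"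
    and prim: "\<And>y. y \<in> D \<Longrightarrow> F x - (y - x) \<bullet> B x - LL (y - x) \<bullet> v \<le> F y"
    and dual: "\<And>y. y \<in> E \<Longrightarrow> \<Psi> (LL x) + (y - LL x) \<bullet> v \<le> \<Psi> y"
    using vi_composite_multiplier[OF HH GG F DH \<Psi> EG BH Blip Bmono LL x0 cone coercive] by blast
  have xH: "x \<in> HH" using x DH by blast
  have xi: "x $ i \<in> eff_dom (H i) (\<phi> i)" for i using x by (simp add: D_def D\<phi>_def)
  have Lxk: "L k x \<in> eff_dom (G k) (g k)" if "k \<in> K" for k
  proof -
    have "LL x $ k \<in> Dg k" using Lx unfolding E_def by blast
    then show ?thesis using that by (simp add: LL_def Dg_def)
  qed
  define q where "q i = (\<Sum>k\<in>K. adjoint_between HH (L k) (v $ k) $ i)" for i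
  have adj: "adjoint_between HH (L k) (v $ k) \<in> HH"
    "\<And>y. y \<in> HH \<Longrightarrow> L k y \<bullet> v $ k = y \<bullet> adjoint_between HH (L k) (v $ k)" if "k \<in> K" for k
    using adjoint_between[OF HH c_L[OF that, folded HH_def]] by auto
  (* A deviation of a single player changes x by a vector supported on one axis. *)
  have axis_H: "axis i (u - x $ i) \<in> HH" if "u \<in> H i" for i u
    using replace_HH[OF xH that] xH subH unfolding replace_comp_diff[symmetric]
    by (intro subspace_diff)
  have L_axis: "(\<Sum>k\<in>K. L k (axis i (u - x $ i)) \<bullet> v $ k) = (u - x $ i) \<bullet> q i" if "u \<in> H i" for i u
  proof -
    have "(\<Sum>k\<in>K. L k (axis i (u - x $ i)) \<bullet> v $ k)
        = (\<Sum>k\<in>K. (u - x $ i) \<bullet> adjoint_between HH (L k) (v $ k) $ i)"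
      using adj(2)[OF _ axis_H[OF that]] by (intro sum.cong) (auto simp: inner_axis')
    then show ?thesis by (simp add: q_def inner_sum_right)
  qed
  have qH: "q i \<in> H i" for i
    unfolding q_def using adj(1) HH_nth by (intro subspace_sum subHi) auto

  have sg\<phi>: "ereal ((u - x $ i) \<bullet> (- B x $ i - q i)) + \<phi> i (x $ i) \<le> \<phi> i u" if u: "u \<in> H i" for i u
  proof (rule ereal_subgradient[OF a xi _ u])
    fix y assume y: "y \<in> eff_dom (H i) (\<phi> i)"
    then have yH: "y \<in> H i" by (simp add: eff_dom_def)
    have "replace_comp i y x \<in> D" using x y by (auto simp: D_def D\<phi>_def replace_comp_nth)
    note prim[OF this]
    moreover have "F (replace_comp i y x) = F x + h\<phi> i y - h\<phi> i (x $ i)"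
      unfolding F_def by (rule sum_replace_comp)
    moreover have "LL (axis i (y - x $ i)) \<bullet> v = (\<Sum>k\<in>K. L k (axis i (y - x $ i)) \<bullet> v $ k)"
      unfolding inner_vec_def by (rule sum.mono_neutral_cong_right) (auto simp: LL_def)
    ultimately show "real_of_ereal (\<phi> i (x $ i)) + (y - x $ i) \<bullet> (- B x $ i - q i) \<le> real_of_ereal (\<phi> i y)"
      using L_axis[OF yH]
      by (simp add: replace_comp_diff inner_axis' h\<phi>_def inner_diff_right)
  qed
  have sgg: "ereal ((y - L k x) \<bullet> v $ k) + g k (L k x) \<le> g k y" if k: "k \<in> K" and y: "y \<in> G k" for k y
  proof (rule ereal_subgradient[OF c_g[OF k] Lxk[OF k] _ y])
    fix y assume y: "y \<in> eff_dom (G k) (g k)"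
    have "y \<in> Dg k" using y k by (simp add: Dg_def)
    then have "replace_comp k y (LL x) \<in> E"
      using Lx by (simp add: E_def replace_comp_nth)
    note dual[OF this]
    moreover have "\<Psi> (replace_comp k y (LL x)) = \<Psi> (LL x) + hg k y - hg k (LL x $ k)"
      unfolding \<Psi>_def by (rule sum_replace_comp)
    ultimately show "real_of_ereal (g k (L k x)) + (y - L k x) \<bullet> v $ k \<le> real_of_ereal (g k y)"
      using k by (simp add: replace_comp_diff inner_axis' hg_def LL_def)
  qed

  have "(x, v) \<in> primal_dual_set H \<phi> f K G g L"
    unfolding primal_dual_set_def mem_Collect_eq prod.case
  proof (intro conjI allI ballI)
    show "x \<in> hilbert_sum UNIV H" using xH by (simp add: HH_def)
    show "v \<in> hilbert_sum K G" using v by (simp add: GG_def)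
    fix i
    have "- B x $ i - q i \<in> H i"
      using grad(1)[OF xH] qH subHi by (metis subspace_diff subspace_neg)
    then have "- B x $ i - q i \<in> subdiff (H i) (\<phi> i) (x $ i)"
      using sg\<phi> HH_nth[OF xH] by (simp add: subdiff_def)
    then show "- partial_gradient H f i x
        - (\<Sum>k\<in>K. adjoint_between (hilbert_sum UNIV H) (L k) (v $ k) $ i)
        \<in> subdiff (H i) (\<phi> i) (x $ i)"
      by (simp add: B_def pseudo_gradient_def q_def HH_def)
  next
    fix k assume k: "k \<in> K"
    then have "v $ k \<in> G k" using v by (simp add: GG_def hilbert_sum_def)
    then show "L k x \<in> subdiff (G k) (fenchel_conj (G k) (g k)) (v $ k)"
      using sgg[OF k] by (intro subdiff_fenchel_conj[OF c_g[OF k] Lxk[OF k]])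
  qed
  moreover have "x $ i \<in> Argmin (H i) (\<lambda>u. \<phi> i u + ereal (f i (replace_comp i u x))
      + (\<Sum>k\<in>K. g k (L k (replace_comp i u x))))" (is "_ \<in> Argmin _ ?h") for i
  proof -
    have "?h (x $ i) \<le> ?h u" if u: "u \<in> H i" for u
    proof -
      define d where "d = u - x $ i"
      obtain r where r: "\<phi> i (x $ i) = ereal r" using Gamma0_ereal_real[OF a xi] by blast
      have "\<forall>k. \<exists>s. k \<in> K \<longrightarrow> g k (L k x) = ereal s"
        using Gamma0_ereal_real[OF c_g Lxk] by blast
      then obtain s where s: "\<And>k. k \<in> K \<Longrightarrow> g k (L k x) = ereal (s k)" by metis
      have sums: "(\<Sum>k\<in>K. g k (L k x)) = ereal (\<Sum>k\<in>K. s k)"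
        using s by simp
      have f_le: "f i x + d \<bullet> B x $ i \<le> f i (replace_comp i u x)"
        using convex_gradient_inequality[OF H b_convex[OF xH[unfolded HH_def]] grad(2)[OF xH] HH_nth[OF xH] u]
        by (simp add: replace_comp_same d_def)
      have "ereal (L k (axis i d) \<bullet> v $ k + s k) \<le> g k (L k (replace_comp i u x))" if k: "k \<in> K" for k
      proof -
        note Llin = bounded_linear_betweenD[OF c_L[OF k, folded HH_def] subH]
        have "L k (replace_comp i u x) - L k x = L k (axis i d)"
          using Llin(3)[OF replace_HH[OF xH u] xH] by (simp add: replace_comp_diff d_def)
        then show ?thesis
          using sgg[OF k Llin(1)[OF replace_HH[OF xH u]]] by (simp add: s[OF k])
      qed
      then have "(\<Sum>k\<in>K. ereal (L k (axis i d) \<bullet> v $ k + s k)) \<le> (\<Sum>k\<in>K. g k (L k (replace_comp i u x)))"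
        by (rule sum_mono)
      moreover have "(\<Sum>k\<in>K. ereal (L k (axis i d) \<bullet> v $ k + s k)) = ereal (d \<bullet> q i + (\<Sum>k\<in>K. s k))"
        using L_axis[OF u] by (simp add: sum.distrib d_def)
      ultimately have g_le: "ereal (d \<bullet> q i + (\<Sum>k\<in>K. s k)) \<le> (\<Sum>k\<in>K. g k (L k (replace_comp i u x)))"
        by simp
      (* The three lower bounds for the cost of player i have slopes that add up to 0. *)
      have "?h (x $ i) = ereal (d \<bullet> (- B x $ i - q i) + r) + ereal (f i x + d \<bullet> B x $ i)
          + ereal (d \<bullet> q i + (\<Sum>k\<in>K. s k))"
        by (simp add: replace_comp_same r sums inner_diff_right)
      also have "\<dots> \<le> ?h u"
        using sg\<phi>[OF u] f_le g_le by (intro add_mono) (simp_all add: r d_def)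
      finally show ?thesis .
    qed
    then show ?thesis
      using HH_nth[OF xH] by (auto simp: Argmin_def is_arg_min_def not_less)
  qed
  ultimately show ?thesis using xH unfolding HH_def by blast
qed

end
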